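(* Let $F$ be a two-dimensional lattice. There exist Banach spaces $X_1$ and $X_2$ such that $X_1\oplus_F X_2$ is a Daugavet range if and only if $F\in\mathfrak{N}_2$.
   Context: All Banach spaces are real and different from $\{0\}$. A nonzero continuous linear operator $G:X\to Y$ between Banach spaces is a Daugavet center if every (bounded) rank-1 operator $T:X\to Y$ satisfies $\|G+T\|=\|G\|+\|T\|$. A Banach space $X$ is a Daugavet range if there exist a Banach space $E$ and a Daugavet center $G:E\to X$. A two-dimensional lattice is a space $F=(\mathbb{R}^2,\|\cdot\|)$, where the norm satisfies $\|(1,0)\|=\|(0,1)\|=1$ and $\|(a_1,a_2)\|=\|(|a_1|,|a_2|)\|$ for all $(a_1,a_2)$, ordered coordinatewise. For Banach spaces $X_1,X_2$, $X_1\oplus_F X_2$ is the space of pairs $(x_1,x_2)$, $x_i\in X_i$, with norm $\|(x_1,x_2)\|=\|(\|x_1\|,\|x_2\|)\|_F$. $S_F^+=\{a\in F:\|a\|=1,\ a\ge 0\}$. $\mathfrak{N}_2$ is the class of those two-dimensional lattices $F$ for which $S_F^+$ is a polygon with at most two edges, i.e. a polygonal arc from $(1,0)$ to $(0,1)$ consisting of at most two edges (maximal nondegenerate line segments). *)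

theory Defs
  imports "HOL-Analysis.Analysis" "HOL-Library.Equipollence"
begin

text \<open>
  HOL cannot quantify over types inside a formula, so a Banach space whose existence is to be
  asserted is a value: a linear subspace of a real vector space type together with a norm on it.
  The values of \<open>nrm\<close> outside \<open>carr\<close> are irrelevant.
\<close>

record 'a nspace =
  carr :: "'a set"
  nrm :: "'a \<Rightarrow> real"

definition norm_on :: "'a::real_vector set \<Rightarrow> ('a \<Rightarrow> real) \<Rightarrow> bool" where
  "norm_on S N \<longleftrightarrow>
     (\<forall>x\<in>S. 0 \<le> N x \<and> (N x = 0 \<longleftrightarrow> x = 0)) \<and>
     (\<forall>c. \<forall>x\<in>S. N (c *\<^sub>R x) = \<bar>c\<bar> * N x) \<and>
     (\<forall>x\<in>S. \<forall>y\<in>S. N (x + y) \<le> N x + N y)"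

definition complete_on :: "'a::real_vector set \<Rightarrow> ('a \<Rightarrow> real) \<Rightarrow> bool" where
  "complete_on S N \<longleftrightarrow>
     (\<forall>s :: nat \<Rightarrow> 'a. (\<forall>n. s n \<in> S) \<and>
        (\<forall>e>0. \<exists>M. \<forall>m\<ge>M. \<forall>n\<ge>M. N (s m - s n) < e) \<longrightarrow>
        (\<exists>l\<in>S. (\<lambda>n. N (s n - l)) \<longlonglongrightarrow> 0))"

text \<open>All Banach spaces are real and different from \<open>{0}\<close>.\<close>

definition banach_space :: "'a::real_vector nspace \<Rightarrow> bool" where
  "banach_space X \<longleftrightarrow>
     subspace (carr X) \<and> carr X \<noteq> {0} \<and> norm_on (carr X) (nrm X) \<and> complete_on (carr X) (nrm X)"

lemma banach_space_UNIV:
  assumes "(UNIV :: 'a::banach set) \<noteq> {0}"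
  shows "banach_space \<lparr>carr = (UNIV :: 'a set), nrm = norm\<rparr>"
proof -
  have "\<exists>l. (\<lambda>n. norm (s n - l)) \<longlonglongrightarrow> 0"
    if "\<forall>e>0. \<exists>M. \<forall>m\<ge>M. \<forall>n\<ge>M. norm (s m - s n) < e" for s :: "nat \<Rightarrow> 'a"
  proof -
    have "Cauchy s" using that by (simp add: Cauchy_iff)
    then obtain l where "s \<longlonglongrightarrow> l" using Cauchy_convergent convergent_def by blast
    then show ?thesis using LIM_zero tendsto_norm_zero by blast
  qed
  then show ?thesis
    using assms by (auto simp: banach_space_def norm_on_def complete_on_def norm_triangle_ineq)
qed

text \<open>An operator is a function on the whole type of which only the values on \<open>carr X\<close> matter.\<close>

definition bounded_operator ::
    "'a::real_vector nspace \<Rightarrow> 'b::real_vector nspace \<Rightarrow> ('a \<Rightarrow> 'b) \<Rightarrow> bool" where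
  "bounded_operator X Y f \<longleftrightarrow>
     (\<forall>x\<in>carr X. f x \<in> carr Y) \<and>
     (\<forall>x\<in>carr X. \<forall>y\<in>carr X. f (x + y) = f x + f y) \<and>
     (\<forall>c. \<forall>x\<in>carr X. f (c *\<^sub>R x) = c *\<^sub>R f x) \<and>
     (\<exists>K. \<forall>x\<in>carr X. nrm Y (f x) \<le> K * nrm X x)"

definition op_norm :: "'a nspace \<Rightarrow> 'b nspace \<Rightarrow> ('a \<Rightarrow> 'b) \<Rightarrow> real" where
  "op_norm X Y f = Sup {nrm Y (f x) |x. x \<in> carr X \<and> nrm X x \<le> 1}"

definition rank1_operator ::
    "'a::real_vector nspace \<Rightarrow> 'b::real_vector nspace \<Rightarrow> ('a \<Rightarrow> 'b) \<Rightarrow> bool" where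
  "rank1_operator X Y T \<longleftrightarrow> bounded_operator X Y T \<and> dim (T ` carr X) = 1"

definition daugavet_center ::
    "'a::real_vector nspace \<Rightarrow> 'b::real_vector nspace \<Rightarrow> ('a \<Rightarrow> 'b) \<Rightarrow> bool" where
  "daugavet_center X Y G \<longleftrightarrow>
     bounded_operator X Y G \<and> (\<exists>x\<in>carr X. G x \<noteq> 0) \<and>
     (\<forall>T. rank1_operator X Y T \<longrightarrow>
        op_norm X Y (\<lambda>x. G x + T x) = op_norm X Y G + op_norm X Y T)"

text \<open>The first argument names the type in which the domain of the Daugavet center is sought.\<close>

definition daugavet_range :: "'e::real_vector itself \<Rightarrow> 'a::real_vector nspace \<Rightarrow> bool" where
  "daugavet_range _ X \<longleftrightarrow>
     banach_space X \<and> (\<exists>(E :: 'e nspace) G. banach_space E \<and> daugavet_center E X G)"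

text \<open>A two-dimensional lattice is represented by its norm.\<close>

definition two_dim_lattice :: "(real \<times> real \<Rightarrow> real) \<Rightarrow> bool" where
  "two_dim_lattice F \<longleftrightarrow>
     norm_on UNIV F \<and> F (1, 0) = 1 \<and> F (0, 1) = 1 \<and>
     (\<forall>a b. F (a, b) = F (\<bar>a\<bar>, \<bar>b\<bar>))"

definition lattice_sum ::
    "(real \<times> real \<Rightarrow> real) \<Rightarrow> 'a nspace \<Rightarrow> 'b nspace \<Rightarrow> ('a \<times> 'b) nspace" where
  "lattice_sum F X Y =
     \<lparr>carr = carr X \<times> carr Y, nrm = (\<lambda>(x, y). F (nrm X x, nrm Y y))\<rparr>"

definition pos_sphere :: "(real \<times> real \<Rightarrow> real) \<Rightarrow> (real \<times> real) set" where
  "pos_sphere F = {(a, b). F (a, b) = 1 \<and> 0 \<le> a \<and> 0 \<le> b}"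

definition line_segment :: "(real \<times> real) set \<Rightarrow> bool" where
  "line_segment L \<longleftrightarrow> (\<exists>p q. p \<noteq> q \<and> L = closed_segment p q)"

definition edges :: "(real \<times> real) set \<Rightarrow> (real \<times> real) set set" where
  "edges A = {L. line_segment L \<and> L \<subseteq> A \<and>
     (\<forall>L'. line_segment L' \<and> L \<subseteq> L' \<and> L' \<subseteq> A \<longrightarrow> L' = L)}"

text \<open>
  For a two-dimensional lattice the positive part of the unit sphere is always an arc from
  \<open>(1, 0)\<close> to \<open>(0, 1)\<close>; it is polygonal with at most two edges if and only if it is covered by
  its edges and there are at most two of them.
\<close>

definition N2 :: "(real \<times> real \<Rightarrow> real) set" where
  "N2 = {F. two_dim_lattice F \<and> finite (edges (pos_sphere F)) \<and>
            card (edges (pos_sphere F)) \<le> 2 \<and> pos_sphere F = \<Union> (edges (pos_sphere F))}"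

text \<open>
  The existence of Banach spaces in vector space types \<open>'a\<close>, \<open>'b\<close>, \<open>'e\<close> is asserted
  uniformly in these types: since they are arbitrary (and every Banach space lives in some type),
  the implication from left to right covers all Banach spaces.  In the other direction a type must
  have room for the spaces.  This is what the condition \<open>\<exists>B. independent B \<and> (UNIV :: real set) \<lesssim> B\<close>
  says: every infinite-dimensional Banach space has linear dimension at least the continuum,
  so the condition excludes only types in which all Banach spaces are finite-dimensional.
\<close>

end

theory Submission
  imports Defs
begin

text \<open>
  The class \<open>N2\<close> consists of the lattices \<open>F\<close> with a point \<open>(p, q) \<ge> 0\<close> such that \<open>F (p, q) = 1\<close> and
  \<open>F (p + 1, q) = F (p, q + 1) = 2\<close>: the segments from \<open>(p, q)\<close> to the unit vectors then lie on the
  unit sphere, and \<open>F\<close> is additive on the two cones they span, so \<open>F ((p, q) + a) = 1 + F a\<close> for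
  all \<open>a \<ge> 0\<close>.

  If \<open>G : E \<rightarrow> X1 \<oplus>\<^sub>F X2\<close> is a Daugavet center with \<open>\<parallel>G\<parallel> = 1\<close> and \<open>e1\<close>, \<open>e2\<close> are unit vectors of
  \<open>X1\<close>, \<open>X2\<close>, then some \<open>x\<close> in the unit ball almost satisfies \<open>\<parallel>G x \<plusminus> (e1, 0)\<parallel> = 2\<close>, for one sign,
  and \<open>\<parallel>G x + (0, e2)\<parallel> = 2\<close>. The norms of the components of \<open>G x\<close> are an approximate \<open>(p, q)\<close>, and
  compactness gives an exact one.

  Conversely, \<open>f \<mapsto> (p f, q f)\<close> is a Daugavet center from \<open>C\<^sub>b(\<real>)\<close> to \<open>C\<^sub>b(\<real>) \<oplus>\<^sub>F C\<^sub>b(\<real>)\<close>: the values of a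
  function near peaks of given \<open>y1\<close>, \<open>y2\<close> can be changed to \<open>\<plusminus> 1\<close> with little effect on a given
  bounded functional. The space \<open>C\<^sub>b(\<real>)\<close> embeds linearly into all types in question, because it has
  the cardinality of the continuum.
\<close>

section \<open>Two-dimensional lattices\<close>

lemma lattice_normD:
  assumes "two_dim_lattice F"
  shows lattice_scale: "F (c * a, c * b) = \<bar>c\<bar> * F (a, b)"
    and lattice_triangle: "F (a + a', b + b') \<le> F (a, b) + F (a', b')"
    and lattice_nonneg: "0 \<le> F (a, b)"
    and lattice_eq_0_iff: "F (a, b) = 0 \<longleftrightarrow> a = 0 \<and> b = 0"
    and lattice_abs: "F (\<bar>a\<bar>, \<bar>b\<bar>) = F (a, b)"
    and lattice_unit: "F (1, 0) = 1" "F (0, 1) = 1"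
proof -
  have N: "norm_on UNIV F" and e: "\<forall>a b. F (a, b) = F (\<bar>a\<bar>, \<bar>b\<bar>)"
    using assms by (auto simp: two_dim_lattice_def)
  from N have s: "F (c *\<^sub>R x) = \<bar>c\<bar> * F x" and t: "F (x + y) \<le> F x + F y"
    and n: "0 \<le> F x" and z: "F x = 0 \<longleftrightarrow> x = 0" for x y c
    unfolding norm_on_def by blast+
  show "F (c * a, c * b) = \<bar>c\<bar> * F (a, b)" using s[of c "(a,b)"] by simp
  show "F (a + a', b + b') \<le> F (a, b) + F (a', b')" using t[of "(a,b)" "(a',b')"] by simp
  show "0 \<le> F (a, b)" by (rule n)
  show "F (a, b) = 0 \<longleftrightarrow> a = 0 \<and> b = 0" using z[of "(a,b)"] by (simp add: zero_prod_def)
  show "F (\<bar>a\<bar>, \<bar>b\<bar>) = F (a, b)" using e by metis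
  show "F (1, 0) = 1" "F (0, 1) = 1" using assms by (auto simp: two_dim_lattice_def)
qed

lemma lattice_axes:
  assumes "two_dim_lattice F"
  shows "F (a, 0) = \<bar>a\<bar>" "F (0, b) = \<bar>b\<bar>"
  using lattice_scale[OF assms, of a 1 0] lattice_scale[OF assms, of b 0 1] lattice_unit[OF assms]
  by auto

lemma lattice_le_sum:
  assumes "two_dim_lattice F"
  shows "F (a, b) \<le> \<bar>a\<bar> + \<bar>b\<bar>"
  using lattice_triangle[OF assms, of a 0 0 b] lattice_axes[OF assms] by simp

text \<open>Monotonicity holds because \<open>a\<close> is a convex combination of \<open>a'\<close> and \<open>- a'\<close>.\<close>

lemma lattice_mono_fst:
  assumes "two_dim_lattice F" "\<bar>a\<bar> \<le> a'"
  shows "F (a, b) \<le> F (a', b)"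
proof (cases "a' = 0")
  case True
  then show ?thesis using assms by simp
next
  case False
  define t where "t = (1 + a / a') / 2"
  have a': "a' > 0" using False assms by simp
  have t: "0 \<le> t" "t \<le> 1" using assms a' by (auto simp: t_def field_simps)
  have m: "F (- a', b) = F (a', b)"
    using lattice_abs[OF assms(1), of a' b] lattice_abs[OF assms(1), of "- a'" b] by simp
  have "F (a, b) = F (t * a' + (1 - t) * (- a'), t * b + (1 - t) * b)"
    using a' by (simp add: t_def field_simps)
  also have "\<dots> \<le> F (t * a', t * b) + F ((1 - t) * (- a'), (1 - t) * b)"
    by (rule lattice_triangle[OF assms(1)])
  also have "\<dots> = \<bar>t\<bar> * F (a', b) + \<bar>1 - t\<bar> * F (a', b)"
    unfolding lattice_scale[OF assms(1)] m ..
  also have "\<dots> = F (a', b)" using t by (simp add: algebra_simps)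
  finally show ?thesis .
qed

text \<open>Reflecting the coordinates lets a statement about the first coordinate be reused for the
  second.\<close>

lemma lattice_swap:
  assumes "two_dim_lattice F"
  shows "two_dim_lattice (\<lambda>(a, b). F (b, a))"
  unfolding two_dim_lattice_def norm_on_def
  using lattice_scale[OF assms] lattice_triangle[OF assms] lattice_nonneg[OF assms]
    lattice_eq_0_iff[OF assms] lattice_unit[OF assms] lattice_abs[OF assms]
  by (auto simp: zero_prod_def)

lemma lattice_mono:
  assumes "two_dim_lattice F" "\<bar>a\<bar> \<le> a'" "\<bar>b\<bar> \<le> b'"
  shows "F (a, b) \<le> F (a', b')"
  using lattice_mono_fst[OF assms(1,2), of b] lattice_mono_fst[OF lattice_swap[OF assms(1)] assms(3), of a']
  by simp

lemma lattice_ge_abs: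
  assumes "two_dim_lattice F"
  shows "\<bar>a\<bar> \<le> F (a, b)" "\<bar>b\<bar> \<le> F (a, b)"
  using lattice_mono[OF assms, of a "\<bar>a\<bar>" 0 "\<bar>b\<bar>"] lattice_mono[OF assms, of 0 "\<bar>a\<bar>" b "\<bar>b\<bar>"]
    lattice_axes[OF assms] lattice_abs[OF assms]
  by auto

text \<open>The norm is dominated by the sum of the absolute values of the coordinates, each of
  which is at most the Euclidean distance; hence the Lipschitz constant 2.\<close>

lemma lattice_continuous:
  assumes "two_dim_lattice F"
  shows "continuous_on S F"
proof -
  have d: "F x - F y \<le> 2 * dist x y" for x y
  proof -
    have "F x \<le> F y + F (x - y)"
      using lattice_triangle[OF assms, of "fst y" "fst (x - y)" "snd y" "snd (x - y)"]
      by (simp flip: minus_prod_def add: prod_eq_iff)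
    moreover have "F (x - y) \<le> \<bar>fst (x - y)\<bar> + \<bar>snd (x - y)\<bar>"
      using lattice_le_sum[OF assms, of "fst (x - y)" "snd (x - y)"]
      by (simp flip: minus_prod_def add: prod_eq_iff)
    moreover have "\<bar>fst (x - y)\<bar> \<le> dist x y" "\<bar>snd (x - y)\<bar> \<le> dist x y"
      using dist_fst_le[of x y] dist_snd_le[of x y] by (auto simp: dist_real_def)
    ultimately show ?thesis by linarith
  qed
  have "dist (F x) (F y) \<le> 2 * dist x y" for x y
    using d[of x y] d[of y x] by (simp add: dist_real_def dist_commute abs_le_iff)
  then have "2-lipschitz_on S F" by (intro lipschitz_onI) auto
  then show ?thesis by (rule lipschitz_on_continuous_on)
qed

text \<open>The two values 2 are cases of equality in the triangle inequality with the unit vectors.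
  The corner may be degenerate: for the l1 norm every point of the positive sphere qualifies, the
  unit vectors included.\<close>

definition cone_point :: "(real \<times> real \<Rightarrow> real) \<Rightarrow> real \<Rightarrow> real \<Rightarrow> bool" where
  "cone_point F p q \<longleftrightarrow> 0 \<le> p \<and> 0 \<le> q \<and> F (p, q) = 1 \<and> F (p + 1, q) = 2 \<and> F (p, q + 1) = 2"

text \<open>Equality in the triangle inequality for two unit vectors spreads to the cone they span.
  For \<open>s \<le> t\<close>, \<open>t\<close> times the sum of the vectors is the given
  combination plus \<open>t - s\<close> times the first vector, so \<open>2 * t\<close> is at most
  the norm of the combination plus \<open>t - s\<close>.\<close>

lemma lattice_additive:
  assumes "two_dim_lattice F" "F (a, b) = 1" "F (c, d) = 1" "F (a + c, b + d) = 2" "0 \<le> s" "0 \<le> t"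
  shows "F (s * a + t * c, s * b + t * d) = s + t"
proof -
  \<comment> \<open>The vectors are generalized as well, so that the case \<open>t \<le> s\<close>
    follows by exchanging them.\<close>
  have *: "F (s * a + t * c, s * b + t * d) \<ge> s + t"
    if h: "F (a, b) = 1" "F (c, d) = 1" "F (a + c, b + d) = 2" "0 \<le> s" "s \<le> t" for a b c d s t
  proof -
    have "t * 2 = F (t * (a + c), t * (b + d))" using lattice_scale[OF assms(1), of t "a + c" "b + d"] h by simp
    also have "\<dots> = F ((s * a + t * c) + (t - s) * a, (s * b + t * d) + (t - s) * b)"
      by (simp add: algebra_simps)
    also have "\<dots> \<le> F (s * a + t * c, s * b + t * d) + F ((t - s) * a, (t - s) * b)"
      by (rule lattice_triangle[OF assms(1)])
    also have "F ((t - s) * a, (t - s) * b) = t - s"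
      unfolding lattice_scale[OF assms(1)] using h by simp
    finally show ?thesis by simp
  qed
  have "F (s * a + t * c, s * b + t * d) \<ge> s + t"
  proof (cases "s \<le> t")
    case True
    then show ?thesis using *[OF assms(2-5)] by simp
  next
    case False
    then show ?thesis using *[OF assms(3,2), of t s] assms by (simp add: add.commute)
  qed
  moreover have "F (s * a + t * c, s * b + t * d) \<le> s + t"
    using lattice_triangle[OF assms(1), of "s * a" "t * c" "s * b" "t * d"]
    unfolding lattice_scale[OF assms(1)] using assms by simp
  ultimately show ?thesis by simp
qed

text \<open>The ray through \<open>(p, q)\<close> cuts the quadrant into two cones, and the sign of
  \<open>q * a - p * b\<close> tells them apart. The factors 1 and 0 are spelled out to match the
  shape of \<open>lattice_additive\<close>.\<close>

lemma quadrant_cases: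
  fixes a b p q :: real
  assumes "0 \<le> a" "0 \<le> b" "0 \<le> p" "0 \<le> q" "(p, q) \<noteq> (0, 0)"
  obtains s t where "0 \<le> s" "0 \<le> t" "a = s * 1 + t * p" "b = s * 0 + t * q"
  | s t where "0 \<le> s" "0 \<le> t" "a = s * 0 + t * p" "b = s * 1 + t * q"
proof -
  note cone = that
  have le1: thesis if "q > 0" "p * b \<le> q * a"
  proof (rule cone(1)[of "a - b / q * p" "b / q"])
    show "0 \<le> a - b / q * p" using that assms by (simp add: field_simps)
  qed (use that assms in auto)
  have le2: thesis if "p > 0" "q * a \<le> p * b"
  proof (rule cone(2)[of "b - a / p * q" "a / p"])
    show "0 \<le> b - a / p * q" using that assms by (simp add: field_simps)
  qed (use that assms in auto)
  consider "p = 0" "q > 0" | "q = 0" "p > 0" | "p > 0" "q > 0" using assms by fastforce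
  then show thesis
  proof cases
    case 1
    then show thesis using le1 assms by simp
  next
    case 2
    then show thesis using le2 assms by simp
  next
    case 3
    then show thesis using le1 le2 by linarith
  qed
qed

lemma cone_point_cases:
  assumes "two_dim_lattice F" "cone_point F p q" "0 \<le> a" "0 \<le> b"
  obtains s t where "0 \<le> s" "0 \<le> t" "a = s * 1 + t * p" "b = s * 0 + t * q" "F (a, b) = s + t"
  | s t where "0 \<le> s" "0 \<le> t" "a = s * 0 + t * p" "b = s * 1 + t * q" "F (a, b) = s + t"
proof -
  note c = assms(2)[unfolded cone_point_def]
  have nz: "(p, q) \<noteq> (0, 0)" using c lattice_axes[OF assms(1), of 0] by auto
  from c have c': "0 \<le> p" "0 \<le> q" by auto
  note u = lattice_unit[OF assms(1)]
  from assms(3,4) c' nz show thesis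
  proof (cases rule: quadrant_cases)
    case (1 s t)
    then show thesis
      using that(1)[OF 1] lattice_additive[OF assms(1) u(1), of p q s t] c by (simp add: add.commute)
  next
    case (2 s t)
    then show thesis
      using that(2)[OF 2] lattice_additive[OF assms(1) u(2), of p q s t] c by (simp add: add.commute)
  qed
qed

text \<open>Adding the corner raises its coefficient \<open>t\<close> by one and does not leave the
  cone, where the norm is \<open>s + t\<close>.\<close>

lemma cone_point_add:
  assumes "two_dim_lattice F" "cone_point F p q" "0 \<le> a" "0 \<le> b"
  shows "F (p + a, q + b) = 1 + F (a, b)"
  using assms
proof (cases rule: cone_point_cases)
  case (1 s t)
  then show ?thesis
    using lattice_additive[OF assms(1) lattice_unit(1)[OF assms(1)], of p q s "t + 1"] assms(2)
    by (simp add: cone_point_def algebra_simps)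
next
  case (2 s t)
  then show ?thesis
    using lattice_additive[OF assms(1) lattice_unit(2)[OF assms(1)], of p q s "t + 1"] assms(2)
    by (simp add: cone_point_def algebra_simps)
qed

text \<open>Radial projection maps the segment from \<open>(1, 0)\<close> to \<open>(0, 1)\<close>
  continuously onto the positive sphere. Connectedness later forces two closed edges that cover the
  sphere to meet.\<close>

lemma pos_sphere_connected:
  assumes "two_dim_lattice F"
  shows "connected (pos_sphere F)"
proof -
  define r where "r t = (1 / F (1 - t, t)) *\<^sub>R (1 - t, t)" for t
  have nz: "F (1 - t, t) \<noteq> 0" for t using lattice_eq_0_iff[OF assms] by auto
  have pos: "F (1 - t, t) > 0" for t using nz[of t] lattice_nonneg[OF assms, of "1 - t" t] by simp
  have "continuous_on {0..1} (\<lambda>t. F (1 - t, t))"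
    by (intro continuous_on_compose2[OF lattice_continuous[OF assms, of UNIV]] continuous_intros) auto
  then have "continuous_on {0..1} r"
    unfolding r_def by (intro continuous_intros) (use nz in auto)
  then have "connected (r ` {0..1})" by (intro connected_continuous_image) auto
  moreover have "r ` {0..1} = pos_sphere F"
  proof (intro set_eqI iffI)
    fix x assume "x \<in> r ` {0..1}"
    then obtain t where t: "x = r t" "t \<in> {0..1}" by auto
    have "F (r t) = 1"
      using lattice_scale[OF assms, of "1 / F (1 - t, t)" "1 - t" t] pos[of t] by (simp add: r_def)
    then show "x \<in> pos_sphere F" using t pos[of t] by (simp add: pos_sphere_def r_def)
  next
    fix x assume "x \<in> pos_sphere F"
    then obtain a b where x: "x = (a, b)" "F (a, b) = 1" "0 \<le> a" "0 \<le> b" by (auto simp: pos_sphere_def)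
    then have s: "a + b > 0" using lattice_le_sum[OF assms, of a b] by simp
    \<comment> \<open>The parameter at which the ray through \<open>x\<close> crosses that
      segment.\<close>
    define t where "t = b / (a + b)"
    have t: "1 - t = (1 / (a + b)) * a" "t = (1 / (a + b)) * b" using s by (auto simp: t_def field_simps)
    have "F (1 - t, t) = 1 / (a + b)"
      using lattice_scale[OF assms, of "1 / (a + b)" a b] t s x by simp
    then have "r t = x" using x s by (auto simp: r_def t_def field_simps)
    moreover have "t \<in> {0..1}" using x s by (auto simp: t_def)
    ultimately show "x \<in> r ` {0..1}" by blast
  qed
  ultimately show ?thesis by simp
qed

lemma sum_in_sphere_segment:
  assumes "two_dim_lattice F" "line_segment L" "L \<subseteq> pos_sphere F" "(a, b) \<in> L" "(c, d) \<in> L"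
  shows "F (a + c, b + d) = 2"
proof -
  have "convex L" using assms(2) by (auto simp: line_segment_def)
  then have "(1/2) *\<^sub>R (a, b) + (1/2) *\<^sub>R (c, d) \<in> L" using assms(4,5) by (intro convexD) auto
  then have "F ((1/2) * (a + c), (1/2) * (b + d)) = 1"
    using assms(3) by (auto simp: pos_sphere_def add_divide_distrib)
  then show ?thesis unfolding lattice_scale[OF assms(1)] by simp
qed

text \<open>Take an edge through each unit vector. If they differ, they are all the edges, so two
  closed sets cover a connected one and must intersect. Any common point is a corner, since it
  shares an edge with either unit vector.\<close>

lemma N2_imp_cone_point:
  assumes "F \<in> N2"
  shows "\<exists>p q. cone_point F p q"
proof -
  let ?A = "pos_sphere F"
  have F: "two_dim_lattice F" and fin: "finite (edges ?A)" and card: "card (edges ?A) \<le> 2"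
    and cov: "?A = \<Union> (edges ?A)" using assms by (auto simp: N2_def)
  note u = lattice_unit[OF F]
  have "(1, 0) \<in> ?A" "(0, 1) \<in> ?A" using u by (auto simp: pos_sphere_def)
  then obtain L1 L2 where L: "L1 \<in> edges ?A" "(1, 0) \<in> L1" "L2 \<in> edges ?A" "(0, 1) \<in> L2"
    using cov by blast
  have seg: "line_segment L1" "L1 \<subseteq> ?A" "line_segment L2" "L2 \<subseteq> ?A" using L by (auto simp: edges_def)
  have "L1 \<inter> L2 \<noteq> {}"
  proof (cases "L1 = L2")
    case True
    then show ?thesis using L by auto
  next
    case False
    then have "{L1, L2} = edges ?A" using L fin card by (intro card_seteq) auto
    then have A: "?A = L1 \<union> L2" using cov by auto
    have cl: "closed L1" "closed L2" using seg by (auto simp: line_segment_def)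
    have "L1 \<inter> ?A \<noteq> {}" "L2 \<inter> ?A \<noteq> {}" using L A by auto
    then show ?thesis
      using connected_closedD[OF pos_sphere_connected[OF F] _ _ cl] A by (metis Int_empty_left order_refl)
  qed
  then obtain p q where v: "(p, q) \<in> L1" "(p, q) \<in> L2" by auto
  then have "0 \<le> p" "0 \<le> q" "F (p, q) = 1" using seg by (auto simp: pos_sphere_def)
  moreover have "F (p + 1, q) = 2" using sum_in_sphere_segment[OF F seg(1,2) v(1) L(2)] by simp
  moreover have "F (p, q + 1) = 2" using sum_in_sphere_segment[OF F seg(3,4) v(2) L(4)] by simp
  ultimately show ?thesis by (auto simp: cone_point_def)
qed

section \<open>Edges of a positive sphere that is made of one or two segments\<close>

lemma edges_line_segment:
  assumes "line_segment A"
  shows "edges A = {A}"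
  using assms by (auto simp: edges_def)

text \<open>Each segment inside the union lies in one of the two pieces, so maximal segments can
  only be the pieces; as neither contains the other, both are maximal.\<close>

lemma edges_two_segments:
  assumes "line_segment S1" "line_segment S2" "\<not> S1 \<subseteq> S2" "\<not> S2 \<subseteq> S1"
    and "\<And>L. line_segment L \<Longrightarrow> L \<subseteq> S1 \<union> S2 \<Longrightarrow> L \<subseteq> S1 \<or> L \<subseteq> S2"
  shows "edges (S1 \<union> S2) = {S1, S2}"
proof (intro set_eqI iffI)
  fix L assume "L \<in> edges (S1 \<union> S2)"
  then have L: "line_segment L" "L \<subseteq> S1 \<union> S2"
    and max: "line_segment L' \<Longrightarrow> L \<subseteq> L' \<Longrightarrow> L' \<subseteq> S1 \<union> S2 \<Longrightarrow> L' = L" for L'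
    by (auto simp: edges_def)
  show "L \<in> {S1, S2}" using assms(5)[OF L] max[OF assms(1)] max[OF assms(2)] by auto
next
  fix L assume L: "L \<in> {S1, S2}"
  have "L' = L" if "line_segment L'" "L \<subseteq> L'" "L' \<subseteq> S1 \<union> S2" for L'
    using assms(5)[OF that(1,3)]
  proof
    assume "L' \<subseteq> S1"
    then show ?thesis using that(2) L assms(4) by auto
  next
    assume "L' \<subseteq> S2"
    then show ?thesis using that(2) L assms(3) by auto
  qed
  then show "L \<in> edges (S1 \<union> S2)" using L assms by (auto simp: edges_def)
qed

text \<open>In the cone coordinates the norm is \<open>s + t\<close>, so norm 1 means a convex
  combination of the corner and a unit vector.\<close>

lemma cone_point_segments:
  assumes F: "two_dim_lattice F" and c: "cone_point F p q"
  shows "pos_sphere F = closed_segment (1, 0) (p, q) \<union> closed_segment (p, q) (0, 1)"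
proof -
  note c' = c[unfolded cone_point_def]
  note u = lattice_unit[OF F]
  show ?thesis
  proof (intro set_eqI iffI)
    fix x assume "x \<in> pos_sphere F"
    then obtain a b where x: "x = (a, b)" "F (a, b) = 1" "0 \<le> a" "0 \<le> b" by (auto simp: pos_sphere_def)
    from F c x(3,4) show "x \<in> closed_segment (1, 0) (p, q) \<union> closed_segment (p, q) (0, 1)"
    proof (cases rule: cone_point_cases)
      case (1 s t)
      then have "s = 1 - t" using x by simp
      then show ?thesis using x 1 by (intro UnI1) (auto simp: in_segment intro!: exI[of _ t])
    next
      case (2 s t)
      then have "t = 1 - s" using x by simp
      then show ?thesis using x 2 by (intro UnI2) (auto simp: in_segment intro!: exI[of _ s])
    qed
  next
    fix x assume "x \<in> closed_segment (1, 0) (p, q) \<union> closed_segment (p, q) (0, 1)"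
    then consider t where "0 \<le> t" "t \<le> 1" "x = ((1 - t) * 1 + t * p, (1 - t) * 0 + t * q)"
      | t where "0 \<le> t" "t \<le> 1" "x = ((1 - t) * p + t * 0, (1 - t) * q + t * 1)"
      unfolding Un_iff in_segment by auto
    then show "x \<in> pos_sphere F"
    proof cases
      case (1 t)
      then have "F x = 1" using lattice_additive[OF F u(1), of p q "1 - t" t] c' by (simp add: add.commute)
      then show ?thesis using 1 c' by (simp add: pos_sphere_def)
    next
      case (2 t)
      then have "F x = 1" using lattice_additive[OF F _ u(2), of p q "1 - t" t] c' by simp
      then show ?thesis using 2 c' by (simp add: pos_sphere_def)
    qed
  qed
qed

lemma line_segmentE:
  assumes "line_segment L"
  obtains x y where "x \<noteq> y" "L = closed_segment x y"
  using assms by (force simp: line_segment_def)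

text \<open>A corner with \<open>p + q = 1\<close> lies on the segment between the unit vectors,
  which is then the only edge. Otherwise the two segments lie on different lines meeting only at the
  corner, and no segment can bend around it.\<close>

lemma cone_point_imp_N2:
  assumes F: "two_dim_lattice F" and c: "cone_point F p q"
  shows "F \<in> N2"
proof -
  note c' = c[unfolded cone_point_def]
  note A = cone_point_segments[OF F c]
  have pq: "p \<le> 1" "q \<le> 1" "1 \<le> p + q"
    using lattice_ge_abs[OF F, of p q] lattice_ge_abs[OF F, of q p] lattice_le_sum[OF F, of p q] c' by auto
  show ?thesis
  proof (cases "p + q = 1")
    case True
    have "(p, q) \<in> closed_segment (1, 0) (0, 1)"
      using True c' by (auto simp: in_segment intro!: exI[of _ q])
    then have "pos_sphere F = closed_segment (1, 0) (0, 1)" unfolding A by (rule Un_closed_segment)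
    then have "line_segment (pos_sphere F)" unfolding line_segment_def
      by (intro exI[of _ "(1, 0)"] exI[of _ "(0, 1)"]) simp
    then show ?thesis using F edges_line_segment by (simp add: N2_def)
  next
    case False
    then have s: "p + q > 1" using pq by simp
    then have pos: "p > 0" "q > 0" using pq by auto
    let ?S1 = "closed_segment (1, 0) (p, q)" and ?S2 = "closed_segment (p, q) (0, 1)"
    define f1 where "f1 x = q * fst x + (1 - p) * snd x" for x :: "real \<times> real"
    define f2 where "f2 x = (1 - q) * fst x + p * snd x" for x :: "real \<times> real"
    \<comment> \<open>\<open>f1 = q\<close> and \<open>f2 = p\<close> are the lines through the two segments.\<close>
    have lin: "f1 (x + y) = f1 x + f1 y" "f1 (k *\<^sub>R x) = k * f1 x"
              "f2 (x + y) = f2 x + f2 y" "f2 (k *\<^sub>R x) = k * f2 x" for x y k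
      by (simp_all add: f1_def f2_def algebra_simps)
    have ev: "f1 (1, 0) = q" "f1 (p, q) = q" "f2 (p, q) = p" "f2 (0, 1) = p"
      by (simp_all add: f1_def f2_def algebra_simps)
    \<comment> \<open>Each unit vector lies strictly on the inner side of the line through the
      opposite segment; this is where \<open>p + q > 1\<close> enters.\<close>
    have lt: "f1 (0, 1) < q" "f2 (1, 0) < p" using s by (simp_all add: f1_def f2_def)
    have on1: "f1 x = q" and le1: "f2 x \<le> p" and eq1: "f2 x = p \<Longrightarrow> x = (p, q)" if mem: "x \<in> ?S1" for x
    proof -
      obtain t where t: "x = (1 - t) *\<^sub>R (1, 0) + t *\<^sub>R (p, q)" "0 \<le> t" "t \<le> 1"
        using mem by (auto simp: in_segment)
      show "f1 x = q" by (simp only: t(1) lin ev) (simp add: algebra_simps)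
      have e: "f2 x = (1 - t) * f2 (1, 0) + t * p" by (simp only: t(1) lin ev)
      have "(1 - t) * f2 (1, 0) \<le> (1 - t) * p" using t lt by (intro mult_left_mono) auto
      then show "f2 x \<le> p" using e by (simp add: algebra_simps)
      assume "f2 x = p"
      then have "(1 - t) * (p - f2 (1, 0)) = 0" using e by (simp add: algebra_simps)
      then show "x = (p, q)" using t lt by auto
    qed
    have on2: "f2 x = p" and le2: "f1 x \<le> q" and eq2: "f1 x = q \<Longrightarrow> x = (p, q)" if mem: "x \<in> ?S2" for x
    proof -
      obtain t where t: "x = (1 - t) *\<^sub>R (p, q) + t *\<^sub>R (0, 1)" "0 \<le> t" "t \<le> 1"
        using mem by (auto simp: in_segment)
      show "f2 x = p" by (simp only: t(1) lin ev) (simp add: algebra_simps)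
      have e: "f1 x = (1 - t) * q + t * f1 (0, 1)" by (simp only: t(1) lin ev)
      have "t * f1 (0, 1) \<le> t * q" using t lt by (intro mult_left_mono) auto
      then show "f1 x \<le> q" using e by (simp add: algebra_simps)
      assume "f1 x = q"
      then have "t * (q - f1 (0, 1)) = 0" using e by (auto simp: algebra_simps)
      then show "x = (p, q)" using t lt by auto
    qed
    \<comment> \<open>If the midpoint lies on the line of one segment together with an endpoint, the
      other endpoint lies on that line too, and so it is the corner, which belongs to both
      segments.\<close>
    have mix: "x \<in> ?S2 \<or> y \<in> ?S1"
      if "x \<in> ?S1" "y \<in> ?S2" "(1/2) *\<^sub>R x + (1/2) *\<^sub>R y \<in> ?S1 \<union> ?S2" for x y
      using that(3)
    proof
      assume "(1/2) *\<^sub>R x + (1/2) *\<^sub>R y \<in> ?S1"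
      from on1[OF this] have "f1 y = q" using on1[OF that(1)] unfolding lin by simp
      then show ?thesis using eq2[OF that(2)] by simp
    next
      assume "(1/2) *\<^sub>R x + (1/2) *\<^sub>R y \<in> ?S2"
      from on2[OF this] have "f2 x = p" using on2[OF that(2)] unfolding lin by simp
      then show ?thesis using eq1[OF that(1)] by simp
    qed
    have "L \<subseteq> ?S1 \<or> L \<subseteq> ?S2" if seg: "line_segment L" and sub: "L \<subseteq> ?S1 \<union> ?S2" for L
    proof -
      from seg obtain x y where L: "L = closed_segment x y" by (elim line_segmentE)
      have m: "(1/2) *\<^sub>R x + (1/2) *\<^sub>R y \<in> ?S1 \<union> ?S2"
      proof (rule subsetD[OF sub])
        show "(1/2) *\<^sub>R x + (1/2) *\<^sub>R y \<in> L"
          unfolding L in_segment by (rule exI[of _ "1/2"]) simp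
      qed
      have "x \<in> ?S1 \<union> ?S2" "y \<in> ?S1 \<union> ?S2"
        by (rule subsetD[OF sub], simp add: L)+
      \<comment> \<open>Testing the endpoints and the midpoint of \<open>L\<close> is enough,
        because each piece is convex.\<close>
      then have "x \<in> ?S1 \<and> y \<in> ?S1 \<or> x \<in> ?S2 \<and> y \<in> ?S2"
        using mix[of x y, OF _ _ m] mix[of y x, OF _ _ m[unfolded add.commute[of "(1/2) *\<^sub>R x"]]]
        unfolding Un_iff by argo
      then show ?thesis
        unfolding L
        using closed_segment_subset[of x ?S1 y] closed_segment_subset[of x ?S2 y] convex_closed_segment
        by metis
    qed
    moreover have "(1, 0) \<notin> ?S2" "(0, 1) \<notin> ?S1" using on1[of "(0, 1)"] on2[of "(1, 0)"] lt by auto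
    then have "\<not> ?S1 \<subseteq> ?S2" "\<not> ?S2 \<subseteq> ?S1"
      using ends_in_segment(1)[of "(1, 0)" "(p, q)"] ends_in_segment(2)[of "(0, 1)" "(p, q)"] by auto
    moreover have "line_segment ?S1"
      using pos unfolding line_segment_def by (intro exI[of _ "(1, 0)"] exI[of _ "(p, q)"]) simp
    moreover have "line_segment ?S2"
      using pos unfolding line_segment_def by (intro exI[of _ "(p, q)"] exI[of _ "(0, 1)"]) simp
    ultimately have "edges (pos_sphere F) = {?S1, ?S2}" unfolding A by (intro edges_two_segments)
    moreover have "card {?S1, ?S2} \<le> 2" by (simp add: card_insert_if)
    ultimately show ?thesis using F A by (simp add: N2_def)
  qed
qed

section \<open>The Hahn--Banach theorem\<close>

text \<open>Homogeneity is an inequality for positive factors because this is easy to check for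
  infima; applying it to the inverse factor gives equality in
  \<open>sublinear_scale\<close>.\<close>

definition sublinear :: "('a::real_vector \<Rightarrow> real) \<Rightarrow> bool" where
  "sublinear q \<longleftrightarrow> (\<forall>x y. q (x + y) \<le> q x + q y) \<and> (\<forall>c>0. \<forall>x. q (c *\<^sub>R x) \<le> c * q x)"

lemma sublinear_zero:
  assumes "sublinear q"
  shows "q 0 = 0"
proof -
  have "q 0 \<le> 2 * q 0" "q 0 \<le> (1/2) * q 0"
    using assms scaleR_zero_right unfolding sublinear_def
    by (metis zero_less_numeral, metis half_gt_zero zero_less_one)
  then show ?thesis by simp
qed

lemma sublinear_scale:
  assumes "sublinear q" "0 \<le> c"
  shows "q (c *\<^sub>R x) = c * q x"
proof (cases "c = 0")
  case True
  then show ?thesis using sublinear_zero[OF assms(1)] by simp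
next
  case False
  then have c: "c > 0" using assms by simp
  then have "q ((1 / c) *\<^sub>R (c *\<^sub>R x)) \<le> (1 / c) * q (c *\<^sub>R x)"
    using assms(1) unfolding sublinear_def by (metis zero_less_divide_1_iff)
  then have "c * q x \<le> q (c *\<^sub>R x)" using c by (simp add: field_simps)
  moreover have "q (c *\<^sub>R x) \<le> c * q x" using assms(1) c by (auto simp: sublinear_def)
  ultimately show ?thesis by simp
qed

lemma sublinear_minus:
  assumes "sublinear q"
  shows "- q (- x) \<le> q x"
proof -
  have "q (x + - x) \<le> q x + q (- x)" using assms by (simp only: sublinear_def)
  then show ?thesis using sublinear_zero[OF assms] by simp
qed

text \<open>These infima are the bounds of chains in Zorn's lemma. They are finite because every
  member is at least \<open>- N (- x)\<close>. Subadditivity uses the chain condition: the smaller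
  of \<open>q\<close> and \<open>r\<close> bounds the infimum at \<open>x + y\<close> by
  \<open>q x + r y\<close>.\<close>

lemma sublinear_chain_Inf:
  assumes "C \<noteq> {}" "\<And>q. q \<in> C \<Longrightarrow> sublinear q" "\<And>q x. q \<in> C \<Longrightarrow> q x \<le> N x"
    and "\<And>q r. q \<in> C \<Longrightarrow> r \<in> C \<Longrightarrow> (\<forall>x. q x \<le> r x) \<or> (\<forall>x. r x \<le> q x)"
  shows "sublinear (\<lambda>x. INF q\<in>C. q x)" and "\<And>q x. q \<in> C \<Longrightarrow> (INF q\<in>C. q x) \<le> q x"
proof -
  let ?u = "\<lambda>x. INF q\<in>C. q x"
  have bd: "bdd_below ((\<lambda>q. q x) ` C)" for x
  proof (rule bdd_belowI2)
    fix q assume "q \<in> C"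
    then show "- N (- x) \<le> q x" using sublinear_minus[OF assms(2), of q x] assms(3)[of q "- x"] by simp
  qed
  show le: "?u x \<le> q x" if "q \<in> C" for q x using cINF_lower[OF bd that] .
  have "?u (x + y) \<le> ?u x + ?u y" for x y
  proof -
    have *: "?u (x + y) \<le> q x + r y" if qr: "q \<in> C" "r \<in> C" for q r
    proof -
      obtain m where m: "m \<in> C" "\<forall>x. m x \<le> q x" "\<forall>x. m x \<le> r x" using assms(4)[OF qr] qr by blast
      have "?u (x + y) \<le> m (x + y)" using le m by blast
      also have "\<dots> \<le> m x + m y" using assms(2)[OF m(1)] by (auto simp: sublinear_def)
      finally show ?thesis using m(2,3) by (smt (verit))
    qed
    \<comment> \<open>The two infima on the right are taken one after the other.\<close>
    have "?u (x + y) - r y \<le> ?u x" if "r \<in> C" for r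
      using assms(1) *[OF _ that] by (intro cINF_greatest) (auto simp: algebra_simps)
    then have "?u (x + y) - ?u x \<le> ?u y"
      using assms(1) by (intro cINF_greatest) (auto simp: algebra_simps)
    then show ?thesis by simp
  qed
  moreover have "?u (c *\<^sub>R x) \<le> c * ?u x" if "c > 0" for c x
  proof -
    have "?u (c *\<^sub>R x) / c \<le> ?u x"
    proof (rule cINF_greatest[OF assms(1)])
      fix q assume q: "q \<in> C"
      have "?u (c *\<^sub>R x) \<le> c * q x"
        using le[OF q, of "c *\<^sub>R x"] assms(2)[OF q] that by (simp add: sublinear_scale)
      then show "?u (c *\<^sub>R x) / c \<le> q x" using that by (simp add: field_simps)
    qed
    then show ?thesis using that by (simp add: field_simps)
  qed
  ultimately show "sublinear ?u" by (simp add: sublinear_def)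
qed

text \<open>The functional is the infimum of \<open>q (x + t v) - t q v\<close> over
  \<open>t \<ge> 0\<close>; \<open>t = 0\<close> gives the comparison with \<open>q\<close>, and
  \<open>t = 1\<close> gives the value at \<open>- v\<close>. It shows that minimal functionals are
  odd, and it also fixes the value at a chosen vector in \<open>norming_functional\<close>.\<close>

lemma sublinear_descend:
  fixes q :: "'a::real_vector \<Rightarrow> real"
  assumes q: "sublinear q"
  obtains r where "sublinear r" "\<And>x. r x \<le> q x" "r (- v) \<le> - q v"
proof -
  let ?h = "\<lambda>x t. q (x + t *\<^sub>R v) - t * q v"
  let ?r = "\<lambda>x. INF t\<in>{0..}. ?h x t"
  have add: "q (x + y) \<le> q x + q y" for x y using q by (auto simp: sublinear_def)
  have bd: "bdd_below (?h x ` {0..})" for x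
  proof (rule bdd_belowI2)
    fix t :: real assume "t \<in> {0..}"
    then show "- q (- x) \<le> ?h x t"
      using add[of "x + t *\<^sub>R v" "- x"] sublinear_scale[OF q, of t v] by simp
  qed
  have le: "?r x \<le> ?h x t" if "0 \<le> t" for x t using cINF_lower[OF bd, of t x] that by simp
  show thesis
  proof
    show "?r x \<le> q x" for x using le[of 0 x] by simp
    show "?r (- v) \<le> - q v" using le[of 1 "- v"] sublinear_zero[OF q] by simp
    have "?r (x + y) \<le> ?r x + ?r y" for x y
    proof -
      have *: "?r (x + y) \<le> ?h x s + ?h y t" if "0 \<le> s" "0 \<le> t" for s t
      proof -
        have "?r (x + y) \<le> ?h (x + y) (s + t)" using that by (intro le) auto
        also have "q (x + y + (s + t) *\<^sub>R v) = q ((x + s *\<^sub>R v) + (y + t *\<^sub>R v))"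
          by (simp add: algebra_simps)
        also have "\<dots> - (s + t) * q v \<le> ?h x s + ?h y t"
          using add[of "x + s *\<^sub>R v" "y + t *\<^sub>R v"] by (simp add: algebra_simps)
        finally show ?thesis .
      qed
      have "?r (x + y) - ?h y t \<le> ?r x" if "0 \<le> t" for t
        using *[OF _ that] by (intro cINF_greatest) (auto simp: algebra_simps)
      then have "?r (x + y) - ?r x \<le> ?r y"
        by (intro cINF_greatest) (auto simp: algebra_simps)
      then show ?thesis by simp
    qed
    moreover have "?r (c *\<^sub>R x) \<le> c * ?r x" if "c > 0" for c x
    proof -
      have "?r (c *\<^sub>R x) / c \<le> ?r x"
      proof (rule cINF_greatest)
        fix t :: real assume t: "t \<in> {0..}"
        have "?r (c *\<^sub>R x) \<le> ?h (c *\<^sub>R x) (c * t)" using that t by (intro le) auto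
        also have "c *\<^sub>R x + (c * t) *\<^sub>R v = c *\<^sub>R (x + t *\<^sub>R v)" by (simp add: scaleR_right_distrib)
        also have "q (c *\<^sub>R (x + t *\<^sub>R v)) - c * t * q v = c * ?h x t" unfolding sublinear_scale[OF q less_imp_le[OF that]] by (simp add: algebra_simps)
        finally show "?r (c *\<^sub>R x) / c \<le> ?h x t" using that by (simp add: field_simps)
      qed auto
      then show ?thesis using that by (simp add: field_simps)
    qed
    ultimately show "sublinear ?r" by (simp add: sublinear_def)
  qed
qed

text \<open>Hahn--Banach: by \<open>sublinear_descend\<close>, a minimal sublinear functional is odd, hence linear.\<close>

lemma linear_below_sublinear:
  fixes N :: "'a::real_vector \<Rightarrow> real"
  assumes N: "sublinear N"
  obtains f where "linear f" "\<And>x. f x \<le> N x"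
proof -
  define A where "A = {q. sublinear q \<and> (\<forall>x. q x \<le> N x)}"
  \<comment> \<open>The order is reversed, so a maximal element in Zorn's lemma is a pointwise
    minimal functional.\<close>
  define P where "P q r \<longleftrightarrow> (\<forall>x. r x \<le> q x)" for q r :: "'a \<Rightarrow> real"
  have "\<exists>m\<in>A. \<forall>a\<in>A. P m a \<longrightarrow> a = m"
  proof (rule predicate_Zorn)
    show "partial_order_on A (relation_of P A)"
      by (rule partial_order_on_relation_ofI) (auto simp: P_def fun_eq_iff intro: order_trans order_antisym)
    fix C assume C: "C \<in> Chains (relation_of P A)"
    then have CA: "q \<in> A" if "q \<in> C" for q
      using that by (auto simp: Chains_def relation_of_def)
    have tot: "(\<forall>x. q x \<le> r x) \<or> (\<forall>x. r x \<le> q x)" if "q \<in> C" "r \<in> C" for q r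
      using that C by (auto simp: Chains_def relation_of_def P_def)
    show "\<exists>u\<in>A. \<forall>a\<in>C. P a u"
    proof (cases "C = {}")
      case True
      then show ?thesis using N by (auto simp: A_def)
    next
      case False
      let ?u = "\<lambda>x. INF q\<in>C. q x"
      have sl: "sublinear q" and qN: "q x \<le> N x" if "q \<in> C" for q x using CA[OF that] by (auto simp: A_def)
      have u: "sublinear ?u"
        by (rule sublinear_chain_Inf(1)[of C N]) (fact False sl qN tot)+
      have ul: "?u x \<le> q x" if "q \<in> C" for q x
        by (rule sublinear_chain_Inf(2)[of C N]) (fact False sl qN tot that)+
      have "?u x \<le> N x" for x using False ul qN by (meson all_not_in_conv order_trans)
      then show ?thesis using u ul by (intro bexI[of _ ?u]) (auto simp: A_def P_def)
    qed
  qed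
  then obtain m where m: "m \<in> A" and min: "\<And>a. a \<in> A \<Longrightarrow> (\<forall>x. a x \<le> m x) \<Longrightarrow> a = m"
    by (auto simp: P_def)
  have sm: "sublinear m" and mN: "m x \<le> N x" for x using m by (auto simp: A_def)
  have odd: "m (- v) = - m v" for v
  proof -
    obtain r where r: "sublinear r" "\<And>x. r x \<le> m x" "r (- v) \<le> - m v"
      using sublinear_descend[OF sm, of v] by blast
    then have "r \<in> A" using mN order_trans unfolding A_def by blast
    then have "r = m" using min r by blast
    then show ?thesis using r(3) sublinear_minus[OF sm, of v] by simp
  qed
  have add: "m (x + y) \<le> m x + m y" for x y using sm by (auto simp: sublinear_def)
  have "linear m"
  proof (rule linearI)
    show "m (x + y) = m x + m y" for x y
      \<comment> \<open>Subadditivity at \<open>x + y\<close> and \<open>- y\<close>, with oddness,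
        is the reverse inequality.\<close>
      using add[of x y] add[of "x + y" "- y"] odd[of y] by simp
    show "m (c *\<^sub>R x) = c *\<^sub>R m x" for c x
    proof (cases "0 \<le> c")
      case True
      then show ?thesis by (simp add: sublinear_scale[OF sm])
    next
      case False
      then show ?thesis using sublinear_scale[OF sm, of "- c" x] odd[of "c *\<^sub>R x"] by simp
    qed
  qed
  then show thesis using that mN by blast
qed

text \<open>A linear projection \<open>P\<close> onto \<open>S\<close> turns the norm into a
  sublinear functional on the whole type. One descent along \<open>v\<close> before the Hahn-Banach
  theorem forces \<open>f (- v) \<le> - N v\<close>, so the norm is attained at
  \<open>v\<close>.\<close>

lemma norming_functional:
  fixes S :: "'a::real_vector set"
  assumes S: "subspace S" and N: "norm_on S N" and v: "v \<in> S"
  obtains f where "linear f" "\<And>x. x \<in> S \<Longrightarrow> \<bar>f x\<bar> \<le> N x" "f v = N v"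
proof -
  obtain P where P: "range P \<subseteq> S" "linear P" "\<And>x. x \<in> S \<Longrightarrow> P x = x"
    using linear_exists_left_inverse_on[OF linear_id S, of] by auto
  have Pin: "P x \<in> S" for x using P by auto
  have "sublinear (\<lambda>x. N (P x))"
    using N Pin by (auto simp: sublinear_def norm_on_def linear_add[OF P(2)] linear_scale[OF P(2)])
  then obtain r where r: "sublinear r" "\<And>x. r x \<le> N (P x)" "r (- v) \<le> - N (P v)"
    using sublinear_descend[of "\<lambda>x. N (P x)" v] by blast
  obtain f where f: "linear f" "\<And>x. f x \<le> r x" using linear_below_sublinear[OF r(1)] by blast
  have fN: "f x \<le> N x" if "x \<in> S" for x using f(2)[of x] r(2)[of x] P(3)[OF that] by simp
  have Nm: "N (- x) = N x" if "x \<in> S" for x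
    using N that unfolding norm_on_def by (metis abs_minus_cancel abs_one mult_1 scaleR_minus1_left)
  show thesis
  proof
    show "\<bar>f x\<bar> \<le> N x" if "x \<in> S" for x
      using fN[OF that] fN[OF subspace_neg[OF S that]] Nm[OF that] linear_neg[OF f(1), of x] by simp
    show "f v = N v"
      using fN[OF v] f(2)[of "- v"] r(3) P(3)[OF v] linear_neg[OF f(1), of v] by simp
  qed (rule f(1))
qed

section \<open>Daugavet centers into a lattice sum\<close>

lemma banach_spaceD:
  assumes "banach_space X"
  shows banach_subspace: "subspace (carr X)"
    and banach_norm_on: "norm_on (carr X) (nrm X)"
    and banach_nonneg: "x \<in> carr X \<Longrightarrow> 0 \<le> nrm X x"
    and banach_eq_0: "x \<in> carr X \<Longrightarrow> nrm X x = 0 \<longleftrightarrow> x = 0"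
    and banach_scale: "x \<in> carr X \<Longrightarrow> nrm X (c *\<^sub>R x) = \<bar>c\<bar> * nrm X x"
    and banach_triangle: "x \<in> carr X \<Longrightarrow> y \<in> carr X \<Longrightarrow> nrm X (x + y) \<le> nrm X x + nrm X y"
    and banach_0: "0 \<in> carr X"
proof -
  show S: "subspace (carr X)" and N: "norm_on (carr X) (nrm X)"
    using assms by (simp_all add: banach_space_def)
  show "0 \<in> carr X" using S by (rule subspace_0)
  show "0 \<le> nrm X x" "nrm X x = 0 \<longleftrightarrow> x = 0" if "x \<in> carr X"
    using N that by (simp_all add: norm_on_def)
  show "nrm X (c *\<^sub>R x) = \<bar>c\<bar> * nrm X x" if "x \<in> carr X"
    using N that by (simp add: norm_on_def)
  show "nrm X (x + y) \<le> nrm X x + nrm X y" if "x \<in> carr X" "y \<in> carr X"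
    using N that by (simp add: norm_on_def)
qed

lemma banach_unit_vector:
  assumes X: "banach_space X"
  obtains e where "e \<in> carr X" "nrm X e = 1"
proof -
  obtain v where v: "v \<in> carr X" "v \<noteq> 0"
    using X banach_0[OF X] unfolding banach_space_def by blast
  then have n: "nrm X v > 0" using banach_nonneg[OF X v(1)] banach_eq_0[OF X v(1)] by simp
  have "(1 / nrm X v) *\<^sub>R v \<in> carr X" using subspace_scale[OF banach_subspace[OF X] v(1)] .
  moreover have "nrm X ((1 / nrm X v) *\<^sub>R v) = 1" using banach_scale[OF X v(1)] n by simp
  ultimately show thesis by (rule that)
qed

lemma op_norm_upper:
  assumes f: "bounded_operator X Y f" and x: "x \<in> carr X" "nrm X x \<le> 1" and X: "banach_space X"
  shows "nrm Y (f x) \<le> op_norm X Y f"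
proof -
  obtain K where K: "\<And>x. x \<in> carr X \<Longrightarrow> nrm Y (f x) \<le> K * nrm X x"
    using f unfolding bounded_operator_def by blast
  \<comment> \<open>The bound \<open>K\<close> may be negative, hence the absolute value.\<close>
  have "nrm Y (f z) \<le> \<bar>K\<bar>" if "z \<in> carr X" "nrm X z \<le> 1" for z
  proof -
    have "nrm Y (f z) \<le> \<bar>K\<bar> * nrm X z"
      using K[OF that(1)] banach_nonneg[OF X that(1)]
      by (meson abs_ge_self mult_right_mono order_trans)
    also have "\<dots> \<le> \<bar>K\<bar> * 1" using that by (intro mult_left_mono) auto
    finally show ?thesis by simp
  qed
  then have "bdd_above {nrm Y (f x) |x. x \<in> carr X \<and> nrm X x \<le> 1}" by (auto intro!: bdd_aboveI)
  then show ?thesis unfolding op_norm_def using x by (intro cSup_upper) auto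
qed

lemma op_norm_approx:
  assumes "banach_space X" "z < op_norm X Y f"
  obtains x where "x \<in> carr X" "nrm X x \<le> 1" "z < nrm Y (f x)"
proof -
  let ?S = "{nrm Y (f x) |x. x \<in> carr X \<and> nrm X x \<le> 1}"
  have "nrm X 0 = 0" using banach_eq_0[OF assms(1) banach_0[OF assms(1)]] by simp
  then have "nrm Y (f 0) \<in> ?S" using banach_0[OF assms(1)] by force
  then have "?S \<noteq> {}" by blast
  from less_cSupD[OF this assms(2)[unfolded op_norm_def]] show thesis using that by blast
qed

lemma op_norm_pos:
  assumes f: "bounded_operator X Y f" and X: "banach_space X" and x: "x \<in> carr X" "nrm Y (f x) > 0"
    and scale: "\<And>c y. y \<in> carr Y \<Longrightarrow> nrm Y (c *\<^sub>R y) = \<bar>c\<bar> * nrm Y y"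
  shows "op_norm X Y f > 0"
proof -
  \<comment> \<open>The summand 1 avoids a division by zero; the rescaled vector still lies in the
    unit ball.\<close>
  define c where "c = 1 / (nrm X x + 1)"
  have c: "c > 0" using banach_nonneg[OF X x(1)] by (simp add: c_def)
  have "nrm X (c *\<^sub>R x) \<le> 1"
    using banach_nonneg[OF X x(1)] unfolding banach_scale[OF X x(1)] by (simp add: c_def)
  moreover have "c *\<^sub>R x \<in> carr X" using subspace_scale[OF banach_subspace[OF X] x(1)] .
  ultimately have "nrm Y (f (c *\<^sub>R x)) \<le> op_norm X Y f" using op_norm_upper[OF f _ _ X] by blast
  moreover have "nrm Y (f (c *\<^sub>R x)) = c * nrm Y (f x)"
    using f x(1) scale c by (simp add: bounded_operator_def)
  ultimately show ?thesis using mult_pos_pos[OF c x(2)] by linarith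
qed

section \<open>Rank-1 operators built from functionals\<close>

abbreviation real_line :: "real nspace" where
  "real_line \<equiv> \<lparr>carr = UNIV, nrm = abs\<rparr>"

lemma dim_line:
  assumes "y \<noteq> 0"
  shows "dim (range (\<lambda>c. c *\<^sub>R y)) = 1"
proof -
  have "range (\<lambda>c. c *\<^sub>R y) = span {y}" by (simp add: span_singleton)
  then show ?thesis using dim_eq_card[of "{y}" "span {y}"] assms by (simp add: span_span)
qed

lemma rank1_operator_functional:
  assumes X: "banach_space X" and Y: "banach_space Y" and phi: "bounded_operator X real_line phi"
    and y: "y \<in> carr Y" "y \<noteq> 0" and x: "x \<in> carr X" "phi x \<noteq> 0"
  shows "rank1_operator X Y (\<lambda>x. phi x *\<^sub>R y)"
proof -
  obtain K where K: "\<forall>x\<in>carr X. \<bar>phi x\<bar> \<le> K * nrm X x" using phi by (auto simp: bounded_operator_def)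
  have "bounded_operator X Y (\<lambda>x. phi x *\<^sub>R y)"
    unfolding bounded_operator_def
  proof (intro conjI)
    show "\<exists>L. \<forall>x\<in>carr X. nrm Y (phi x *\<^sub>R y) \<le> L * nrm X x"
    proof (intro exI ballI)
      fix x assume "x \<in> carr X"
      then have "\<bar>phi x\<bar> * nrm Y y \<le> (K * nrm X x) * nrm Y y"
        using K banach_nonneg[OF Y y(1)] by (intro mult_right_mono) auto
      then show "nrm Y (phi x *\<^sub>R y) \<le> (K * nrm Y y) * nrm X x"
        using banach_scale[OF Y y(1)] by (simp add: algebra_simps)
    qed
  qed (use phi y subspace_scale[OF banach_subspace[OF Y]] in
       \<open>auto simp: bounded_operator_def scaleR_add_left\<close>)
  moreover have "(\<lambda>x. phi x *\<^sub>R y) ` carr X = range (\<lambda>c. c *\<^sub>R y)"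
  proof -
    have "c *\<^sub>R y \<in> (\<lambda>x. phi x *\<^sub>R y) ` carr X" for c
    proof (rule image_eqI[of _ _ "(c / phi x) *\<^sub>R x"])
      show "c *\<^sub>R y = phi ((c / phi x) *\<^sub>R x) *\<^sub>R y"
        using phi x by (simp add: bounded_operator_def)
    qed (use subspace_scale[OF banach_subspace[OF X] x(1)] in auto)
    then show ?thesis by auto
  qed
  ultimately show ?thesis using dim_line[OF y(2)] by (simp add: rank1_operator_def)
qed

text \<open>As \<open>y\<close> is a unit vector, \<open>phi x y\<close> has the operator norm of
  \<open>phi\<close>; the point is a near maximizer in the Daugavet equation for this
  operator.\<close>

lemma daugavet_functional_point:
  assumes X: "banach_space X" and Y: "banach_space Y" and G: "daugavet_center X Y G"
    and phi: "bounded_operator X real_line phi" "x0 \<in> carr X" "phi x0 \<noteq> 0"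
    and y: "y \<in> carr Y" "nrm Y y = 1" and e: "\<epsilon> > 0"
  obtains x where "x \<in> carr X" "nrm X x \<le> 1"
    "nrm Y (G x + phi x *\<^sub>R y) > op_norm X Y G + op_norm X real_line phi - \<epsilon>"
proof -
  let ?T = "\<lambda>x. phi x *\<^sub>R y"
  have "y \<noteq> 0" using y banach_eq_0[OF Y y(1)] by auto
  then have "rank1_operator X Y ?T" using rank1_operator_functional[OF X Y phi(1) y(1) _ phi(2,3)] by simp
  then have "op_norm X Y (\<lambda>x. G x + ?T x) = op_norm X Y G + op_norm X Y ?T"
    using G unfolding daugavet_center_def by blast
  moreover have "op_norm X Y ?T = op_norm X real_line phi"
    unfolding op_norm_def using banach_scale[OF Y y(1)] y(2) by simp
  ultimately have "op_norm X Y G + op_norm X real_line phi - \<epsilon> < op_norm X Y (\<lambda>x. G x + ?T x)"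
    using e by simp
  from op_norm_approx[OF X this] show thesis using that by blast
qed

text \<open>The Daugavet equation for \<open>f\<close> and \<open>y1\<close> makes the functional \<open>\<phi> = h \<circ> G + h y1 f\<close> have almost the
  largest possible norm, where \<open>h\<close> is a norming functional; where \<open>\<phi>\<close> is nearly maximal, \<open>G x\<close> is
  aligned with \<open>y1\<close> up to a sign. The equation for \<open>\<phi>\<close> and \<open>y2\<close> yields such a point that is also
  aligned with \<open>y2\<close>.\<close>

lemma daugavet_two_directions:
  fixes G :: "'e::real_vector \<Rightarrow> 'y::real_vector"
  assumes X: "banach_space X" and Y: "banach_space Y" and G: "daugavet_center X Y G"
    and y1: "y1 \<in> carr Y" "nrm Y y1 = 1" and y2: "y2 \<in> carr Y" "nrm Y y2 = 1" and e: "\<epsilon> > 0"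
  defines "g \<equiv> op_norm X Y G"
  obtains x s where "x \<in> carr X" "nrm X x \<le> 1" "\<bar>s\<bar> = 1"
    "nrm Y (G x + (s * g) *\<^sub>R y1) > 2 * g - \<epsilon>" "nrm Y (G x + g *\<^sub>R y2) > 2 * g - \<epsilon>"
proof -
  have bG: "bounded_operator X Y G" using G by (simp add: daugavet_center_def)
  have Gin: "G x \<in> carr Y" and Gadd: "z \<in> carr X \<Longrightarrow> G (x + z) = G x + G z"
    and Gscale: "G (c *\<^sub>R x) = c *\<^sub>R G x" if "x \<in> carr X" for x z c
    using bG that by (auto simp: bounded_operator_def)
  have Gle: "nrm Y (G x) \<le> g" if "x \<in> carr X" "nrm X x \<le> 1" for x
    unfolding g_def using op_norm_upper[OF bG that X] .
  obtain xg where xg: "xg \<in> carr X" "G xg \<noteq> 0" using G by (auto simp: daugavet_center_def)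
  then have g: "g > 0" unfolding g_def using Gin banach_nonneg[OF Y] banach_eq_0[OF Y] banach_scale[OF Y]
    by (intro op_norm_pos[OF bG X xg(1)]) (auto simp: less_le)
  \<comment> \<open>A functional norming \<open>e0\<close> serves as the nonzero coefficient of the
    first rank-1 operator.\<close>
  obtain e0 where e0: "e0 \<in> carr X" "nrm X e0 = 1" using banach_unit_vector[OF X] .
  obtain f where f: "linear f" "\<And>x. x \<in> carr X \<Longrightarrow> \<bar>f x\<bar> \<le> nrm X x" "f e0 = nrm X e0"
    using norming_functional[OF banach_subspace[OF X] banach_norm_on[OF X] e0(1)] by blast
  define n where "n = op_norm X real_line f"
  have bf: "bounded_operator X real_line f"
    using f(1,2) by (auto simp: bounded_operator_def linear_add linear_scale intro!: exI[of _ 1])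
  have fle: "\<bar>f x\<bar> \<le> n" if "x \<in> carr X" "nrm X x \<le> 1" for x
    unfolding n_def using op_norm_upper[OF bf that X] by simp
  have n: "n > 0" using fle[OF e0(1)] e0 f(3) by simp
  \<comment> \<open>The loss in the direction \<open>y1\<close> will be
    \<open>2 * \<eta> + 2 * \<eta> * g / n\<close>, and in the direction \<open>y2\<close> it will
    be \<open>\<eta>\<close>. The bound \<open>n / 2\<close> guarantees
    \<open>\<phi> x \<ge> g\<close> at the end.\<close>
  define \<eta> where "\<eta> = min (n / 2) (\<epsilon> / (3 + 3 * g / n))"
  have \<eta>: "\<eta> > 0" "2 * \<eta> \<le> n" using n e g by (auto simp: \<eta>_def add_pos_pos)
  have "\<eta> * (3 + 3 * g / n) \<le> \<epsilon>"
  proof -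
    have d: "3 + 3 * g / n > 0" using g n by (simp add: add_pos_pos)
    have "\<eta> \<le> \<epsilon> / (3 + 3 * g / n)" by (simp add: \<eta>_def)
    then show ?thesis using d by (simp add: pos_le_divide_eq)
  qed
  moreover have "\<eta> * (3 + 3 * g / n) = 3 * \<eta> + 3 * (\<eta> * g / n)" by (simp add: algebra_simps)
  moreover have "\<eta> * g / n > 0" using \<eta> g n by simp
  ultimately have \<eta>': "2 * \<eta> + 2 * (\<eta> * g / n) < \<epsilon>" using \<eta> by linarith
  obtain x1 where x1: "x1 \<in> carr X" "nrm X x1 \<le> 1" "nrm Y (G x1 + f x1 *\<^sub>R y1) > g + n - \<eta>"
    using daugavet_functional_point[OF X Y G bf e0(1) _ y1 \<eta>(1)] e0 f(3) unfolding g_def n_def by auto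
  have v: "G x1 + f x1 *\<^sub>R y1 \<in> carr Y"
    using Gin[OF x1(1)] y1(1) banach_subspace[OF Y] by (simp add: subspace_add subspace_scale)
  obtain h where h: "linear h" "\<And>y. y \<in> carr Y \<Longrightarrow> \<bar>h y\<bar> \<le> nrm Y y"
      "h (G x1 + f x1 *\<^sub>R y1) = nrm Y (G x1 + f x1 *\<^sub>R y1)"
    using norming_functional[OF banach_subspace[OF Y] banach_norm_on[OF Y] v] by blast
  define \<phi> where "\<phi> x = h (G x) + h y1 * f x" for x
  have h1: "\<bar>h y1\<bar> \<le> 1" using h(2)[OF y1(1)] y1(2) by simp
  have hG: "\<bar>h (G x)\<bar> \<le> g" if "x \<in> carr X" "nrm X x \<le> 1" for x
    using h(2)[OF Gin] Gle that by (meson order_trans)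
  have b\<phi>: "bounded_operator X real_line \<phi>"
    unfolding bounded_operator_def
  proof (intro conjI)
    obtain K where K: "\<And>x. x \<in> carr X \<Longrightarrow> nrm Y (G x) \<le> K * nrm X x"
      using bG unfolding bounded_operator_def by blast
    show "\<exists>L. \<forall>x\<in>carr X. nrm real_line (\<phi> x) \<le> L * nrm X x"
    proof (intro exI ballI)
      fix x assume x: "x \<in> carr X"
      have "\<bar>h y1 * f x\<bar> \<le> 1 * nrm X x" unfolding abs_mult using h1 f(2)[OF x] by (intro mult_mono) auto
      then show "nrm real_line (\<phi> x) \<le> (K + 1) * nrm X x"
        using h(2)[OF Gin[OF x]] K[OF x] by (simp add: \<phi>_def algebra_simps abs_le_iff)
    qed
  qed (auto simp: \<phi>_def Gadd Gscale linear_add[OF h(1)] linear_scale[OF h(1)]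
        linear_add[OF f(1)] linear_scale[OF f(1)] algebra_simps)
  define m where "m = op_norm X real_line \<phi>"
  have \<phi>m: "\<bar>\<phi> x\<bar> \<le> m" if "x \<in> carr X" "nrm X x \<le> 1" for x
    unfolding m_def using op_norm_upper[OF b\<phi> that X] by simp
  \<comment> \<open>By linearity \<open>\<phi> x1\<close> is \<open>h\<close> evaluated at the
    vector it norms.\<close>
  have \<phi>x1: "\<phi> x1 > g + n - \<eta>"
    using x1(3) h(3) by (simp add: \<phi>_def linear_add[OF h(1)] linear_scale[OF h(1)] mult.commute)
  then have m: "m > g + n - \<eta>" using \<phi>m[OF x1(1,2)] by simp
  have "\<phi> x1 \<noteq> 0" using \<phi>x1 g \<eta> by linarith
  then obtain x2 where x2: "x2 \<in> carr X" "nrm X x2 \<le> 1" "nrm Y (G x2 + \<phi> x2 *\<^sub>R y2) > g + m - \<eta>"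
    using daugavet_functional_point[OF X Y G b\<phi> x1(1) _ y2 \<eta>(1)] unfolding g_def m_def by blast
  \<comment> \<open>Passing from \<open>x2\<close> to its negative changes the sign of
    \<open>\<phi>\<close> and leaves both norms unchanged.\<close>
  obtain x where x: "x \<in> carr X" "nrm X x \<le> 1" "nrm Y (G x + \<phi> x *\<^sub>R y2) > g + m - \<eta>" "\<phi> x \<ge> 0"
  proof (cases "\<phi> x2 \<ge> 0")
    case True
    then show thesis using that x2 by blast
  next
    case False
    have neg: "\<phi> (- x2) = - \<phi> x2" "G (- x2) = - G x2" "nrm X (- x2) = nrm X x2"
      using b\<phi> Gscale[OF x2(1), of "- 1"] banach_scale[OF X x2(1), of "- 1"] x2(1)
      by (auto simp: bounded_operator_def dest: spec[of _ "-1"])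
    have w: "G x2 + \<phi> x2 *\<^sub>R y2 \<in> carr Y"
      using Gin[OF x2(1)] y2(1) banach_subspace[OF Y] by (simp add: subspace_add subspace_scale)
    have "G (- x2) + \<phi> (- x2) *\<^sub>R y2 = (- 1) *\<^sub>R (G x2 + \<phi> x2 *\<^sub>R y2)" by (simp add: neg)
    then have "nrm Y (G (- x2) + \<phi> (- x2) *\<^sub>R y2) = nrm Y (G x2 + \<phi> x2 *\<^sub>R y2)"
      using banach_scale[OF Y w, of "- 1"] by simp
    then show thesis using that[of "- x2"] x2 neg False subspace_neg[OF banach_subspace[OF X]] by simp
  qed
  have Gx: "G x \<in> carr Y" using Gin x(1) by blast
  have cy: "c *\<^sub>R y \<in> carr Y" if "y \<in> carr Y" for c y
    using that banach_subspace[OF Y] by (simp add: subspace_scale)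
  have nsum: "nrm Y (G x + c *\<^sub>R y2) \<le> g + \<bar>c\<bar>" for c
    using banach_triangle[OF Y Gx cy[OF y2(1), of c]] banach_scale[OF Y y2(1)] y2(2) Gle[OF x(1,2)] by simp
  have \<phi>x: "\<phi> x > m - \<eta>" "\<phi> x \<le> m" using nsum[of "\<phi> x"] x(3,4) \<phi>m[OF x(1,2)] by auto
  have hf: "\<bar>h y1 * f x\<bar> \<le> \<bar>h y1\<bar> * n"
    unfolding abs_mult using fle[OF x(1,2)] by (intro mult_left_mono) auto
  have hf': "\<bar>h y1\<bar> * n \<le> n" using h1 n by (simp add: mult_left_le_one_le)
  \<comment> \<open>The summands of \<open>\<phi> x\<close> are at most \<open>g\<close> and
    \<open>n\<close>, and their sum exceeds \<open>g + n - 2 * \<eta>\<close>, so each is within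
    \<open>2 * \<eta>\<close> of its bound.\<close>
  have A: "h (G x) > g - 2 * \<eta>" "\<bar>h y1\<bar> * n > n - 2 * \<eta>"
    using \<phi>x m hf hf' hG[OF x(1,2)] by (auto simp: \<phi>_def)
  then have "\<bar>h y1\<bar> > 1 - 2 * \<eta> / n" using n by (simp add: field_simps)
  then have B: "g * \<bar>h y1\<bar> > g * (1 - 2 * \<eta> / n)" using g by (intro mult_strict_left_mono)
  define s where "s = (if h y1 \<ge> 0 then 1 else - 1 :: real)"
  have s: "\<bar>s\<bar> = 1" "s * h y1 = \<bar>h y1\<bar>" by (auto simp: s_def)
  show thesis
  proof
    show "x \<in> carr X" "nrm X x \<le> 1" "\<bar>s\<bar> = 1" by (fact x s)+
    have "h (G x + (s * g) *\<^sub>R y1) = h (G x) + g * \<bar>h y1\<bar>"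
      using s(2) by (simp add: linear_add[OF h(1)] linear_scale[OF h(1)] algebra_simps)
    moreover have "h (G x + (s * g) *\<^sub>R y1) \<le> nrm Y (G x + (s * g) *\<^sub>R y1)"
      using h(2)[OF subspace_add[OF banach_subspace[OF Y] Gx cy[OF y1(1)]]] abs_le_D1 by blast
    ultimately show "nrm Y (G x + (s * g) *\<^sub>R y1) > 2 * g - \<epsilon>"
      using A(1) B \<eta>' by (simp add: algebra_simps)
    \<comment> \<open>Lowering the coefficient of \<open>y2\<close> from \<open>\<phi> x\<close> to
      \<open>g\<close> costs at most \<open>\<phi> x - g\<close>, and
      \<open>\<phi> x \<le> m\<close>, so only \<open>\<eta>\<close> is lost.\<close>
    have ge: "\<phi> x \<ge> g" using \<phi>x m \<eta> by linarith
    have "G x + \<phi> x *\<^sub>R y2 = (G x + g *\<^sub>R y2) + (\<phi> x - g) *\<^sub>R y2" by (simp add: algebra_simps)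
    then have "nrm Y (G x + \<phi> x *\<^sub>R y2) \<le> nrm Y (G x + g *\<^sub>R y2) + nrm Y ((\<phi> x - g) *\<^sub>R y2)"
      using banach_triangle[OF Y subspace_add[OF banach_subspace[OF Y] Gx cy[OF y2(1)]] cy[OF y2(1)]] by metis
    moreover have "nrm Y ((\<phi> x - g) *\<^sub>R y2) = \<phi> x - g"
      using banach_scale[OF Y y2(1)] y2(2) ge by simp
    moreover have "\<eta> * g / n > 0" using \<eta> g n by simp
    ultimately show "nrm Y (G x + g *\<^sub>R y2) > 2 * g - \<epsilon>"
      using x(3) \<phi>x \<eta>' \<eta> by linarith
  qed
qed

text \<open>The admissible pairs form a compact subset of the unit square, on which the smaller of
  the two norms attains its supremum, at least 2. The triangle inequality bounds both norms by
  \<open>F (p, q) + 1 \<le> 2\<close>, so all these inequalities are equalities.\<close>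

lemma approximate_cone_points:
  assumes F: "two_dim_lattice F"
    and ap: "\<And>\<delta>. \<delta> > 0 \<Longrightarrow> \<exists>p\<ge>0. \<exists>q\<ge>0. F (p, q) \<le> 1 \<and> F (p + 1, q) > 2 - \<delta> \<and> F (p, q + 1) > 2 - \<delta>"
  shows "\<exists>p q. cone_point F p q"
proof -
  let ?C = "cbox (0, 0) (1, 1) \<inter> {x. F x \<le> 1}"
  define k where "k x = min (F (fst x + 1, snd x)) (F (fst x, snd x + 1))" for x
  have "closed {x. F x \<le> 1}"
    using closed_Collect_le[OF lattice_continuous[OF F] continuous_on_const] .
  then have comp: "compact ?C" by (intro compact_Int_closed) auto
  have in_C: "(p, q) \<in> ?C" if "0 \<le> p" "0 \<le> q" "F (p, q) \<le> 1" for p q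
    using that lattice_ge_abs[OF F, of p q] lattice_ge_abs[OF F, of q p] by (auto simp: cbox_Pair_iff)
  have cont: "continuous_on ?C k"
    unfolding k_def
    by (intro continuous_on_min continuous_on_compose2[OF lattice_continuous[OF F, of UNIV]] continuous_intros) auto
  have k: "\<exists>x\<in>?C. k x > 2 - \<delta>" if \<delta>: "\<delta> > 0" for \<delta>
  proof -
    obtain p q where "0 \<le> p" "0 \<le> q" "F (p, q) \<le> 1" "F (p + 1, q) > 2 - \<delta>" "F (p, q + 1) > 2 - \<delta>"
      using ap[OF \<delta>] by blast
    then show ?thesis using in_C by (intro bexI[of _ "(p, q)"]) (auto simp: k_def)
  qed
  from bexE[OF k[OF zero_less_one]] have "?C \<noteq> {}" by (metis empty_iff)
  from continuous_attains_sup[OF comp this cont]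
  obtain z where z: "z \<in> ?C" "\<And>x. x \<in> ?C \<Longrightarrow> k x \<le> k z" by (elim bexE) simp
  obtain p q where pq: "z = (p, q)" by (cases z)
  have "k z \<ge> 2"
  proof (rule field_le_epsilon)
    fix \<delta> :: real assume "\<delta> > 0"
    then show "2 \<le> k z + \<delta>" using k[of \<delta>] z(2) by fastforce
  qed
  moreover have "0 \<le> p" "0 \<le> q" "F (p, q) \<le> 1" using z(1) pq by (auto simp: cbox_Pair_iff)
  moreover have "F (p + 1, q) \<le> F (p, q) + 1" "F (p, q + 1) \<le> F (p, q) + 1"
    using lattice_triangle[OF F, of p 1 q 0] lattice_triangle[OF F, of p 0 q 1] lattice_unit[OF F] by auto
  ultimately have "cone_point F p q" by (auto simp: cone_point_def k_def pq)
  then show ?thesis by blast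
qed

text \<open>For the nearly aligned \<open>G x\<close>, the component norms divided by the norm of
  \<open>G\<close> give \<open>p\<close> and \<open>q\<close>. Monotonicity of \<open>F\<close>
  replaces vectors by their norms, which also removes the unknown sign \<open>s\<close>.\<close>

lemma daugavet_range_imp_cone_point:
  fixes X1 :: "'a::real_vector nspace" and X2 :: "'b::real_vector nspace"
  assumes F: "two_dim_lattice F" and X1: "banach_space X1" and X2: "banach_space X2"
    and range: "daugavet_range TYPE('e::real_vector) (lattice_sum F X1 X2)"
  shows "\<exists>p q. cone_point F p q"
proof (rule approximate_cone_points[OF F])
  fix \<delta> :: real assume \<delta>: "\<delta> > 0"
  let ?Y = "lattice_sum F X1 X2"
  obtain E :: "'e nspace" and G where Y: "banach_space ?Y" and E: "banach_space E"
    and G: "daugavet_center E ?Y G" using range by (auto simp: daugavet_range_def)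
  have carrY: "carr ?Y = carr X1 \<times> carr X2" and nrmY: "nrm ?Y (u, v) = F (nrm X1 u, nrm X2 v)" for u v
    by (auto simp: lattice_sum_def)
  obtain e1 e2 where e: "e1 \<in> carr X1" "nrm X1 e1 = 1" "e2 \<in> carr X2" "nrm X2 e2 = 1"
    using banach_unit_vector[OF X1] banach_unit_vector[OF X2] by metis
  have z: "0 \<in> carr X1" "0 \<in> carr X2" "nrm X1 0 = 0" "nrm X2 0 = 0"
    using banach_0 banach_eq_0 X1 X2 by blast+
  define g where "g = op_norm E ?Y G"
  have bG: "bounded_operator E ?Y G" using G by (simp add: daugavet_center_def)
  obtain xg where xg: "xg \<in> carr E" "G xg \<noteq> 0" using G by (auto simp: daugavet_center_def)
  have "G xg \<in> carr ?Y" using bG xg(1) by (simp add: bounded_operator_def)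
  then have "nrm ?Y (G xg) > 0" using xg(2) banach_nonneg[OF Y] banach_eq_0[OF Y] by (simp add: less_le)
  then have g: "g > 0" unfolding g_def using banach_scale[OF Y] by (intro op_norm_pos[OF bG E xg(1)]) auto
  obtain x s where x: "x \<in> carr E" "nrm E x \<le> 1" "\<bar>s\<bar> = 1"
    "nrm ?Y (G x + (s * g) *\<^sub>R (e1, 0)) > 2 * g - g * \<delta>"
    "nrm ?Y (G x + g *\<^sub>R (0, e2)) > 2 * g - g * \<delta>"
    using daugavet_two_directions[OF E Y G, of "(e1, 0)" "(0, e2)" "g * \<delta>"] e z g \<delta> lattice_unit[OF F]
    unfolding g_def[symmetric] by (auto simp: carrY nrmY)
  obtain u v where uv: "G x = (u, v)" by (cases "G x")
  have "G x \<in> carr ?Y" using bG x(1) by (simp add: bounded_operator_def)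
  then have in_carr: "u \<in> carr X1" "v \<in> carr X2" using uv carrY by auto
  define p where "p = nrm X1 u / g"
  define q where "q = nrm X2 v / g"
  have pq: "0 \<le> p" "0 \<le> q" "nrm X1 u = g * p" "nrm X2 v = g * q"
    using in_carr banach_nonneg[OF X1] banach_nonneg[OF X2] g by (auto simp: p_def q_def)
  have sc: "F (g * a, g * b) = g * F (a, b)" for a b using lattice_scale[OF F, of g] g by simp
  have "g * F (p, q) \<le> g"
    using op_norm_upper[OF bG x(1,2) E] unfolding g_def[symmetric] uv nrmY pq sc .
  then have "F (p, q) \<le> 1" using g by simp
  moreover have "F (p + 1, q) > 2 - \<delta>"
  proof -
    have se: "(s * g) *\<^sub>R e1 \<in> carr X1" using e(1) subspace_scale[OF banach_subspace[OF X1]] by blast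
    have "nrm X1 (u + (s * g) *\<^sub>R e1) \<le> nrm X1 u + nrm X1 ((s * g) *\<^sub>R e1)"
      using banach_triangle[OF X1 in_carr(1) se] .
    also have "\<dots> = g * (p + 1)"
      using banach_scale[OF X1 e(1), of "s * g"] e(2) x(3) g pq by (simp add: abs_mult algebra_simps)
    finally have le: "nrm X1 (u + (s * g) *\<^sub>R e1) \<le> g * (p + 1)" .
    have "2 * g - g * \<delta> < F (nrm X1 (u + (s * g) *\<^sub>R e1), nrm X2 v)"
      using x(4) by (simp add: uv nrmY)
    also have "\<dots> \<le> F (g * (p + 1), g * q)"
      using le pq g banach_nonneg[OF X1 subspace_add[OF banach_subspace[OF X1] in_carr(1) se]]
      by (intro lattice_mono[OF F]) auto
    also have "\<dots> = g * F (p + 1, q)" by (rule sc)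
    finally have "g * (2 - \<delta>) < g * F (p + 1, q)" by (simp add: algebra_simps)
    then show ?thesis using g by simp
  qed
  moreover have "F (p, q + 1) > 2 - \<delta>"
  proof -
    have se: "g *\<^sub>R e2 \<in> carr X2" using e(3) subspace_scale[OF banach_subspace[OF X2]] by blast
    have "nrm X2 (v + g *\<^sub>R e2) \<le> nrm X2 v + nrm X2 (g *\<^sub>R e2)"
      using banach_triangle[OF X2 in_carr(2) se] .
    also have "\<dots> = g * (q + 1)"
      using banach_scale[OF X2 e(3), of g] e(4) g pq by (simp add: algebra_simps)
    finally have le: "nrm X2 (v + g *\<^sub>R e2) \<le> g * (q + 1)" .
    have "2 * g - g * \<delta> < F (nrm X1 u, nrm X2 (v + g *\<^sub>R e2))"
      using x(5) by (simp add: uv nrmY)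
    also have "\<dots> \<le> F (g * p, g * (q + 1))"
      using le pq g banach_nonneg[OF X2 subspace_add[OF banach_subspace[OF X2] in_carr(2) se]]
      by (intro lattice_mono[OF F]) auto
    also have "\<dots> = g * F (p, q + 1)" by (rule sc)
    finally have "g * (2 - \<delta>) < g * F (p, q + 1)" by (simp add: algebra_simps)
    then show ?thesis using g by simp
  qed
  ultimately show "\<exists>p\<ge>0. \<exists>q\<ge>0. F (p, q) \<le> 1 \<and> F (p + 1, q) > 2 - \<delta> \<and> F (p, q + 1) > 2 - \<delta>"
    using pq by blast
qed

section \<open>Bounded continuous functions on the line\<close>

text \<open>The right half of a ball in \<open>U\<close> is cut into \<open>n\<close> intervals of
  length \<open>2 * w\<close>, with midpoints \<open>c i\<close>.\<close>

lemma disjoint_balls_in_open: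
  fixes U :: "real set"
  assumes U: "open U" "U \<noteq> {}" and n: "n > 0"
  obtains c :: "nat \<Rightarrow> real" and w where "w > 0" "\<And>i t. i < n \<Longrightarrow> \<bar>t - c i\<bar> < w \<Longrightarrow> t \<in> U"
    "\<And>i j t. i < n \<Longrightarrow> j < n \<Longrightarrow> i \<noteq> j \<Longrightarrow> \<bar>t - c i\<bar> < w \<Longrightarrow> w \<le> \<bar>t - c j\<bar>"
proof -
  obtain a r where r: "r > 0" "ball a r \<subseteq> U" using U openE by blast
  define w where "w = r / (2 * real n)"
  define c where "c i = a + w * (2 * real i + 1)" for i
  have w: "w > 0" "2 * (w * real n) = r" using r n by (auto simp: w_def)
  show thesis
  proof
    show "w > 0" by fact
    show "t \<in> U" if "i < n" "\<bar>t - c i\<bar> < w" for i t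
    proof -
      have "w * real i \<ge> 0" using w by simp
      moreover have "w * (real i + 1) \<le> w * real n" using that(1) w by (intro mult_left_mono) auto
      moreover have "c i = a + 2 * (w * real i) + w" by (simp add: c_def algebra_simps)
      ultimately have "t - a < r" "- (t - a) < r" using that(2) w unfolding distrib_left by linarith+
      then have "t \<in> ball a r" by (simp add: dist_real_def)
      then show ?thesis using r(2) by blast
    qed
    show "w \<le> \<bar>t - c j\<bar>" if "i \<noteq> j" "\<bar>t - c i\<bar> < w" for i j t
    proof -
      have "w * 1 \<le> w * \<bar>real i - real j\<bar>" using that(1) w by (intro mult_left_mono) auto
      also have "\<dots> = \<bar>w * (real i - real j)\<bar>" using w by (simp add: abs_mult)
      also have "w * (real i - real j) = (c i - c j) / 2" by (simp add: c_def algebra_simps)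
      finally show ?thesis using that(2) by (simp add: abs_le_iff abs_less_iff) arith
    qed
  qed
qed

text \<open>If all values were large, the sum of the \<open>h i\<close> with signs matching those of
  \<open>\<phi> (h i)\<close> would have norm at most \<open>M\<close>, because at each point at
  most one term is nonzero, while \<open>\<phi>\<close> would be at least \<open>n \<delta>\<close>
  on it.\<close>

lemma functional_small_on_disjoint:
  fixes \<phi> :: "(real \<Rightarrow>\<^sub>C real) \<Rightarrow> real" and h :: "nat \<Rightarrow> real \<Rightarrow>\<^sub>C real"
  assumes \<phi>: "linear \<phi>" "\<And>f. \<bar>\<phi> f\<bar> \<le> K * norm f" and K: "0 \<le> K"
    and h: "\<And>i t. i < n \<Longrightarrow> \<bar>h i t\<bar> \<le> M" and M: "0 \<le> M"
    and disj: "\<And>i j t. i < n \<Longrightarrow> j < n \<Longrightarrow> i \<noteq> j \<Longrightarrow> h i t \<noteq> 0 \<Longrightarrow> h j t = 0"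
    and n: "real n * \<delta> > K * M"
  shows "\<exists>i<n. \<bar>\<phi> (h i)\<bar> < \<delta>"
proof (rule ccontr)
  assume "\<not> (\<exists>i<n. \<bar>\<phi> (h i)\<bar> < \<delta>)"
  then have ge: "\<delta> \<le> \<bar>\<phi> (h i)\<bar>" if "i < n" for i using that by (meson not_less)
  define g where "g = (\<Sum>i<n. sgn (\<phi> (h i)) *\<^sub>R h i)"
  have "real n * \<delta> \<le> (\<Sum>i<n. \<bar>\<phi> (h i)\<bar>)" using sum_bounded_below[of "{..<n}" \<delta> "\<lambda>i. \<bar>\<phi> (h i)\<bar>"] ge by simp
  also have "\<dots> = \<phi> g"
    by (simp add: g_def linear_sum[OF \<phi>(1)] linear_scale[OF \<phi>(1)] abs_sgn mult.commute)
  also have "\<dots> \<le> K * norm g" using \<phi>(2)[of g] by simp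
  also have "norm g \<le> M"
  proof (rule norm_bound)
    fix t
    have "linear (\<lambda>f :: real \<Rightarrow>\<^sub>C real. f t)" by (rule linearI) auto
    from linear_sum[OF this, of "\<lambda>i. sgn (\<phi> (h i)) *\<^sub>R h i" "{..<n}"]
    have g: "g t = (\<Sum>i<n. sgn (\<phi> (h i)) * h i t)" by (simp add: g_def)
    have "\<bar>g t\<bar> \<le> M"
    proof (cases "\<exists>j<n. h j t \<noteq> 0")
      case True
      then obtain j where j: "j < n" "h j t \<noteq> 0" by blast
      have "g t = (\<Sum>i\<in>{j}. sgn (\<phi> (h i)) * h i t)"
        unfolding g using j disj by (intro sum.mono_neutral_right) auto
      also have "\<bar>\<dots>\<bar> \<le> 1 * M"
        using h[OF j(1)] by (simp add: abs_mult sgn_real_def M)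
      finally show ?thesis by simp
    next
      case False
      then show ?thesis using M by (simp add: g)
    qed
    then show "norm (g t) \<le> M" by simp
  qed
  finally show False using n K by (simp add: mult_left_mono)
qed

text \<open>A function can be given the value \<open>s\<close> somewhere in \<open>U\<close> at almost no cost for \<open>\<phi>\<close>, since
  there are arbitrarily many disjoint places where it can be done.\<close>

lemma prescribe_value:
  fixes \<phi> :: "(real \<Rightarrow>\<^sub>C real) \<Rightarrow> real"
  assumes \<phi>: "linear \<phi>" "\<And>f. \<bar>\<phi> f\<bar> \<le> K * norm f" and K: "0 \<le> K"
    and f: "\<And>x. \<bar>apply_bcontfun f x\<bar> \<le> 1" and s: "\<bar>s\<bar> \<le> 1" and U: "open U" "U \<noteq> {}" and \<delta>: "\<delta> > 0"
  obtains f' t where "\<And>x. \<bar>apply_bcontfun f' x\<bar> \<le> 1" "t \<in> U" "apply_bcontfun f' t = s"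
    "\<And>x. x \<notin> U \<Longrightarrow> apply_bcontfun f' x = apply_bcontfun f x" "\<bar>\<phi> f' - \<phi> f\<bar> < \<delta>"
proof -
  obtain n :: nat where "real n > max (K * 2 / \<delta>) 0" using reals_Archimedean2 by blast
  then have n: "real n * \<delta> > K * 2" "n > 0" using \<delta> by (auto simp: field_simps)
  obtain c w where w: "w > 0" and inU: "\<And>i t. i < n \<Longrightarrow> \<bar>t - c i\<bar> < w \<Longrightarrow> t \<in> U"
    and dj: "\<And>i j t. i < n \<Longrightarrow> j < n \<Longrightarrow> i \<noteq> j \<Longrightarrow> \<bar>t - c i\<bar> < w \<Longrightarrow> w \<le> \<bar>t - c j\<bar>"
    by (rule disjoint_balls_in_open[OF U n(2)]) (rule that)
  \<comment> \<open>Tent functions with peak 1 at \<open>c i\<close>. Adding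
    \<open>b i (s - f)\<close> to \<open>f\<close> forms a convex combination of \<open>f\<close>
    and \<open>s\<close>, so the bound 1 survives; the correction itself is bounded by 2.\<close>
  define b where "b i t = max 0 (1 - \<bar>t - c i\<bar> / w)" for i t
  have b01: "0 \<le> b i t" "b i t \<le> 1" for i t using w by (auto simp: b_def)
  have b0: "w \<le> \<bar>t - c i\<bar> \<Longrightarrow> b i t = 0" for i t using w by (simp add: b_def)
  define h where "h i = Bcontfun (\<lambda>t. b i t * (s - f t))" for i
  have bound: "\<bar>b i t * (s - f t)\<bar> \<le> 2" for i t
  proof -
    have "\<bar>b i t * (s - f t)\<bar> \<le> 1 * 2"
      unfolding abs_mult using b01[of i t] f[of t] s by (intro mult_mono) auto
    then show ?thesis by simp
  qed
  have "continuous_on UNIV (\<lambda>t. b i t * (s - f t))" for i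
    unfolding b_def using w by (intro continuous_intros) auto
  then have "(\<lambda>t. b i t * (s - f t)) \<in> bcontfun" for i
    by (rule bcontfun_normI[where b = 2]) (use bound in simp)
  then have h: "apply_bcontfun (h i) t = b i t * (s - f t)" for i t
    by (simp add: h_def Bcontfun_inverse)
  have "\<exists>i<n. \<bar>\<phi> (h i)\<bar> < \<delta>"
  proof (rule functional_small_on_disjoint[OF \<phi> K])
    show "h j t = 0" if "i < n" "j < n" "i \<noteq> j" "h i t \<noteq> 0" for i j t
    proof -
      have "\<bar>t - c i\<bar> < w" using b0[of t i] that(4) by (force simp: h)
      then show ?thesis using b0[of t j] dj[OF that(1-3)] by (simp add: h)
    qed
  qed (use bound n in \<open>auto simp: h\<close>)
  then obtain i where i: "i < n" "\<bar>\<phi> (h i)\<bar> < \<delta>" by blast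
  show thesis
  proof
    show "\<bar>apply_bcontfun (f + h i) x\<bar> \<le> 1" for x
    proof -
      have "apply_bcontfun (f + h i) x = (1 - b i x) * f x + b i x * s" by (simp add: h algebra_simps)
      also have "\<bar>\<dots>\<bar> \<le> \<bar>(1 - b i x) * f x\<bar> + \<bar>b i x * s\<bar>" by (rule abs_triangle_ineq)
      also have "\<dots> \<le> (1 - b i x) * 1 + b i x * 1"
        unfolding abs_mult using b01[of i x] f[of x] s by (intro add_mono mult_mono) auto
      finally show ?thesis by simp
    qed
    show "c i \<in> U" using inU[OF i(1), of "c i"] w by simp
    show "apply_bcontfun (f + h i) (c i) = s" by (simp add: h b_def)
    show "apply_bcontfun (f + h i) x = apply_bcontfun f x" if "x \<notin> U" for x
    proof -
      have "w \<le> \<bar>x - c i\<bar>" using inU[OF i(1), of x] that by force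
      then show ?thesis using b0[of x i] by (simp add: h)
    qed
    show "\<bar>\<phi> (f + h i) - \<phi> f\<bar> < \<delta>" using i(2) by (simp add: linear_add[OF \<phi>(1)])
  qed
qed

text \<open>The norm is a supremum that need not be attained on the line, so an open set of near
  peaks takes the place of a maximum point. The sign makes the condition one-sided.\<close>

lemma near_peak_open:
  fixes y :: "real \<Rightarrow>\<^sub>C real"
  assumes "\<delta> > 0"
  obtains \<sigma> where "\<bar>\<sigma>\<bar> = 1" "open {t. \<sigma> * y t > norm y - \<delta>}" "{t. \<sigma> * y t > norm y - \<delta>} \<noteq> {}"
proof -
  have "\<exists>t. \<bar>y t\<bar> > norm y - \<delta>"
  proof (rule ccontr)
    assume "\<not> ?thesis"
    then have "norm y \<le> norm y - \<delta>" by (intro norm_bound) (simp add: not_less)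
    then show False using assms by simp
  qed
  then obtain t where t: "\<bar>y t\<bar> > norm y - \<delta>" by blast
  define \<sigma> where "\<sigma> = (if y t \<ge> 0 then 1 else - 1 :: real)"
  show thesis
  proof
    show "\<bar>\<sigma>\<bar> = 1" by (simp add: \<sigma>_def)
    show "open {t. \<sigma> * y t > norm y - \<delta>}" by (intro open_Collect_less continuous_intros) auto
    have "\<sigma> * y t > norm y - \<delta>" using t by (auto simp: \<sigma>_def)
    then show "{t. \<sigma> * y t > norm y - \<delta>} \<noteq> {}" by blast
  qed
qed

text \<open>The function is changed first near a peak of \<open>y1\<close>, then near one of
  \<open>y2\<close>, to values whose signs match the contributions of \<open>\<phi> f' y1\<close>
  and \<open>\<phi> f' y2\<close> there. Both sums then nearly reach the sum of the norms, and the
  changes move \<open>\<phi>\<close> by less than \<open>2 * \<delta>\<close>.\<close>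

lemma simultaneous_peaks:
  fixes \<phi> :: "(real \<Rightarrow>\<^sub>C real) \<Rightarrow> real" and y1 y2 f :: "real \<Rightarrow>\<^sub>C real"
  assumes \<phi>: "linear \<phi>" "\<And>f. \<bar>\<phi> f\<bar> \<le> K * norm f" and f: "norm f \<le> 1" and \<epsilon>: "\<epsilon> > 0"
  obtains f' where "norm f' \<le> 1"
    "norm (p *\<^sub>R f' + \<phi> f' *\<^sub>R y1) \<ge> p + \<bar>\<phi> f\<bar> * norm y1 - \<epsilon>"
    "norm (q *\<^sub>R f' + \<phi> f' *\<^sub>R y2) \<ge> q + \<bar>\<phi> f\<bar> * norm y2 - \<epsilon>"
proof -
  have \<phi>': "\<bar>\<phi> g\<bar> \<le> \<bar>K\<bar> * norm g" for g
    using \<phi>(2)[of g] by (meson abs_ge_self mult_right_mono norm_ge_zero order_trans)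
  define \<delta> where "\<delta> = \<epsilon> / (\<bar>\<phi> f\<bar> + 2 * norm y1 + 2 * norm y2 + 1)"
  have D: "\<bar>\<phi> f\<bar> + 2 * norm y1 + 2 * norm y2 + 1 > 0"
    using norm_ge_zero[of y1] norm_ge_zero[of y2] abs_ge_zero[of "\<phi> f"] by linarith
  have \<delta>: "\<delta> > 0" "\<delta> * (\<bar>\<phi> f\<bar> + 2 * norm y1 + 2 * norm y2 + 1) = \<epsilon>"
    using \<epsilon> D by (simp_all add: \<delta>_def)
  obtain \<sigma>1 where s1: "\<bar>\<sigma>1\<bar> = 1" "open {t. \<sigma>1 * y1 t > norm y1 - \<delta>}" "{t. \<sigma>1 * y1 t > norm y1 - \<delta>} \<noteq> {}"
    using near_peak_open[OF \<delta>(1)] .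
  obtain \<sigma>2 where s2: "\<bar>\<sigma>2\<bar> = 1" "open {t. \<sigma>2 * y2 t > norm y2 - \<delta>}" "{t. \<sigma>2 * y2 t > norm y2 - \<delta>} \<noteq> {}"
    using near_peak_open[OF \<delta>(1)] .
  define \<tau> where "\<tau> = (if \<phi> f \<ge> 0 then 1 else - 1 :: real)"
  have \<tau>: "\<bar>\<tau>\<bar> = 1" "\<tau> * \<phi> f = \<bar>\<phi> f\<bar>" by (auto simp: \<tau>_def)
  have f1: "\<bar>apply_bcontfun f x\<bar> \<le> 1" for x using norm_bounded[of f x] f by simp
  have "\<bar>\<tau> * \<sigma>1\<bar> \<le> 1" "\<bar>\<tau> * \<sigma>2\<bar> \<le> 1" using \<tau> s1 s2 by (simp_all add: abs_mult)
  note ts = this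
  obtain g t1 where g: "\<And>x. \<bar>apply_bcontfun g x\<bar> \<le> 1" "t1 \<in> {t. \<sigma>1 * y1 t > norm y1 - \<delta>}"
    "apply_bcontfun g t1 = \<tau> * \<sigma>1" "\<bar>\<phi> g - \<phi> f\<bar> < \<delta>"
    by (rule prescribe_value[OF \<phi>(1) \<phi>' abs_ge_zero f1 ts(1) s1(2,3) \<delta>(1)]) (rule that)
  \<comment> \<open>Removing \<open>t1\<close> protects the value prescribed there; a nonempty open
    set of reals is more than one point, so something remains.\<close>
  let ?U = "{t. \<sigma>2 * y2 t > norm y2 - \<delta>} - {t1}"
  have U: "open ?U" using s2(2) by (intro open_Diff) auto
  have U': "?U \<noteq> {}"
  proof
    assume "?U = {}"
    then have "{t. \<sigma>2 * y2 t > norm y2 - \<delta>} = {t1}" using s2(3) by blast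
    then show False using s2(2) not_open_singleton[of t1] by simp
  qed
  obtain f' t2 where f': "\<And>x. \<bar>apply_bcontfun f' x\<bar> \<le> 1" "t2 \<in> ?U"
    "apply_bcontfun f' t2 = \<tau> * \<sigma>2" "\<And>x. x \<notin> ?U \<Longrightarrow> apply_bcontfun f' x = apply_bcontfun g x"
    "\<bar>\<phi> f' - \<phi> g\<bar> < \<delta>"
    by (rule prescribe_value[OF \<phi>(1) \<phi>' abs_ge_zero g(1) ts(2) U U' \<delta>(1)]) (rule that)
  have "apply_bcontfun f' t1 = \<tau> * \<sigma>1" using f'(4)[of t1] g(3) by simp
  have dev: "\<bar>\<phi> f' - \<phi> f\<bar> \<le> 2 * \<delta>" using f'(5) g(4) by linarith
  have key: "norm (r *\<^sub>R f' + \<phi> f' *\<^sub>R y) \<ge> r + \<bar>\<phi> f\<bar> * norm y - \<epsilon>"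
    if v: "apply_bcontfun f' t = \<tau> * \<sigma>" and pk: "\<sigma> * apply_bcontfun y t > norm y - \<delta>"
      and \<sigma>: "\<bar>\<sigma>\<bar> = 1" and le: "norm y \<le> norm y1 + norm y2" for r y t \<sigma>
  proof -
    \<comment> \<open>The sign \<open>\<tau>\<close> belongs to \<open>\<phi> f\<close>, and
      \<open>\<phi> f'\<close> might have the other one when \<open>\<phi> f\<close> is small; only
      the closeness of \<open>a\<close> to \<open>\<bar>\<phi> f\<bar>\<close> is used.\<close>
    define a where "a = \<tau> * \<phi> f'"
    define b where "b = \<sigma> * apply_bcontfun y t"
    have sq: "\<sigma> * \<sigma> = 1" "\<tau> * \<tau> = 1" using \<sigma> \<tau> by (metis abs_mult_self_eq mult_1)+
    have b: "\<bar>b\<bar> \<le> norm y" "b > norm y - \<delta>"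
      using norm_bounded[of y t] \<sigma> pk by (simp_all add: b_def abs_mult)
    have "a - \<bar>\<phi> f\<bar> = \<tau> * (\<phi> f' - \<phi> f)" using \<tau>(2) by (simp add: a_def algebra_simps)
    then have "\<bar>a - \<bar>\<phi> f\<bar>\<bar> \<le> 2 * \<delta>" using dev \<tau>(1) by (simp add: abs_mult)
    then have "\<bar>(a - \<bar>\<phi> f\<bar>) * b\<bar> \<le> (2 * \<delta>) * norm y"
      unfolding abs_mult using b(1) by (intro mult_mono) auto
    then have 1: "a * b \<ge> \<bar>\<phi> f\<bar> * b - 2 * \<delta> * norm y" by (simp add: algebra_simps abs_le_iff)
    have "\<bar>\<phi> f\<bar> * b \<ge> \<bar>\<phi> f\<bar> * (norm y - \<delta>)" using b(2) by (intro mult_left_mono) auto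
    with 1 have 2: "a * b \<ge> \<bar>\<phi> f\<bar> * norm y - \<delta> * (\<bar>\<phi> f\<bar> + 2 * norm y)" by (simp add: algebra_simps)
    have "\<delta> * (\<bar>\<phi> f\<bar> + 2 * norm y) \<le> \<delta> * (\<bar>\<phi> f\<bar> + 2 * norm y1 + 2 * norm y2 + 1)"
      using \<delta>(1) le by (intro mult_left_mono) auto
    with 2 \<delta>(2) have 3: "a * b \<ge> \<bar>\<phi> f\<bar> * norm y - \<epsilon>" by linarith
    have "r * ((\<tau> * \<tau>) * (\<sigma> * \<sigma>)) + a * b = (\<tau> * \<sigma>) * (r * (\<tau> * \<sigma>) + \<phi> f' * y t)"
      by (simp add: a_def b_def algebra_simps)
    then have "r + a * b = (\<tau> * \<sigma>) * (r * (\<tau> * \<sigma>) + \<phi> f' * y t)" unfolding sq by simp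
    also have "\<dots> \<le> \<bar>r * (\<tau> * \<sigma>) + \<phi> f' * y t\<bar>"
      using \<sigma> \<tau>(1) abs_ge_self[of "(\<tau> * \<sigma>) * (r * (\<tau> * \<sigma>) + \<phi> f' * y t)"] by (simp add: abs_mult)
    also have "\<dots> \<le> norm (r *\<^sub>R f' + \<phi> f' *\<^sub>R y)"
      using norm_bounded[of "r *\<^sub>R f' + \<phi> f' *\<^sub>R y" t] v by simp
    finally show ?thesis using 3 by linarith
  qed
  show thesis
  proof
    show "norm f' \<le> 1" using f'(1) by (intro norm_bound) simp
    show "norm (p *\<^sub>R f' + \<phi> f' *\<^sub>R y1) \<ge> p + \<bar>\<phi> f\<bar> * norm y1 - \<epsilon>"
      by (rule key[of t1 \<sigma>1]) (use g f' s1 in auto)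
    show "norm (q *\<^sub>R f' + \<phi> f' *\<^sub>R y2) \<ge> q + \<bar>\<phi> f\<bar> * norm y2 - \<epsilon>"
      by (rule key[of t2 \<sigma>2]) (use g f' s2 in auto)
  qed
qed

text \<open>A continuous function is determined by its values at rationals, hence by the pairs of
  rationals below its graph, which are coded as a set of natural numbers.\<close>

lemma bcontfun_lepoll_real: "(UNIV :: (real \<Rightarrow>\<^sub>C real) set) \<lesssim> (UNIV :: real set)"
proof -
  define D where "D f = {(r, s). of_rat s < apply_bcontfun f (of_rat r)}" for f :: "real \<Rightarrow>\<^sub>C real"
  define code where "code f = to_nat ` D f" for f
  have "inj code"
  proof (rule injI)
    fix f g assume "code f = code g"
    then have D: "D f = D g" unfolding code_def by (simp add: inj_image_eq_iff)
    have le: "f (of_rat r) \<le> g (of_rat r)" if "D f = D g" for f g :: "real \<Rightarrow>\<^sub>C real" and r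
    proof (rule ccontr)
      assume "\<not> ?thesis"
      then obtain s where s: "g (of_rat r) < of_rat s" "of_rat s < f (of_rat r)"
        using of_rat_dense not_le by metis
      then have "(r, s) \<in> D f" "(r, s) \<notin> D g" by (auto simp: D_def)
      then show False using that by simp
    qed
    have rat: "f x = g x" if "x \<in> \<rat>" for x
      using that le[OF D] le[OF D[symmetric]] by (metis Rats_cases order_antisym)
    have "f x = g x" for x
      using continuous_constant_on_closure[of "\<rat>" "\<lambda>x. f x - g x" 0 x] rat
      by (simp add: Rats_closure_real continuous_on_diff)
    then show "f = g" by (rule bcontfun_eqI)
  qed
  then have "(UNIV :: (real \<Rightarrow>\<^sub>C real) set) \<lesssim> (UNIV :: nat set set)" unfolding lepoll_def by blast
  then show ?thesis using nat_sets_eqpoll_reals eqpoll_imp_lepoll lepoll_trans by blast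
qed

text \<open>A Hamel basis of the function space has at most the cardinality of the continuum, so it
  injects into \<open>B\<close>; the linear extension of this injection is injective.\<close>

lemma linear_embedding_exists:
  assumes "\<exists>B :: 'a::real_vector set. independent B \<and> (UNIV :: real set) \<lesssim> B"
  obtains j :: "(real \<Rightarrow>\<^sub>C real) \<Rightarrow> 'a::real_vector" where "linear j" "inj j"
proof -
  obtain B :: "'a set" where B: "independent B" "(UNIV :: real set) \<lesssim> B" using assms by blast
  obtain C :: "(real \<Rightarrow>\<^sub>C real) set" where C: "independent C" "UNIV \<subseteq> span C"
    using basis_exists[of UNIV] by metis
  have "C \<lesssim> B"
    using subset_imp_lepoll[OF subset_UNIV] bcontfun_lepoll_real B(2) lepoll_trans by metis
  then obtain k where k: "inj_on k C" "k ` C \<subseteq> B" by (auto simp: lepoll_def)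
  obtain j where j: "linear j" "\<forall>x\<in>C. j x = k x" using linear_independent_extend[OF C(1), of k] by blast
  have img: "j ` C = k ` C" using j(2) by (auto simp: image_iff)
  have "independent (j ` C)" unfolding img using independent_mono[OF B(1) k(2)] .
  moreover have "inj_on j C" using inj_on_cong[of C j k] j(2) k(1) by auto
  ultimately have "inj_on j (span C)" using linear_inj_on_span_independent_image[OF j(1)] by blast
  moreover have "span C = UNIV" using C(2) by blast
  ultimately show thesis using that j(1) by simp
qed

section \<open>A Daugavet center with diagonal form\<close>

text \<open>An isometric copy of a normed space inside a prescribed type, for an injective linear
  \<open>j\<close>; outside the carrier the values of \<open>inv j\<close> are arbitrary.\<close>

definition transported :: "('c::real_normed_vector \<Rightarrow> 'a::real_vector) \<Rightarrow> 'a nspace" where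
  "transported j = \<lparr>carr = range j, nrm = (\<lambda>x. norm (inv j x))\<rparr>"

lemma nrm_transported: "inj j \<Longrightarrow> nrm (transported j) (j x) = norm x"
  by (simp add: transported_def)

lemma carr_transported: "carr (transported j) = range j"
  by (simp add: transported_def)

lemma banach_space_transported:
  fixes j :: "'c::{real_normed_vector, complete_space} \<Rightarrow> 'a::real_vector"
  assumes j: "linear j" "inj j" and v: "v \<noteq> (0 :: 'c)"
  shows "banach_space (transported j)"
  unfolding banach_space_def carr_transported
proof (intro conjI)
  note n = nrm_transported[OF j(2)]
  show "subspace (range j)" using linear_subspace_image[OF j(1) subspace_UNIV] .
  have "j v \<noteq> 0" using linear_0[OF j(1)] injD[OF j(2), of v 0] v by auto
  then show "range j \<noteq> {0}" by blast
  show "norm_on (range j) (nrm (transported j))"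
    unfolding norm_on_def
  proof (intro conjI ballI allI; elim rangeE; hypsubst)
    show "0 \<le> nrm (transported j) (j x) " for x by (simp add: n)
    show "nrm (transported j) (j x) = 0 \<longleftrightarrow> j x = 0" for x
      using linear_injective_0[OF j(1)] j(2) linear_0[OF j(1)] by (auto simp: n)
    show "nrm (transported j) (c *\<^sub>R j x) = \<bar>c\<bar> * nrm (transported j) (j x)" for c x
      by (simp add: n flip: linear_scale[OF j(1)])
    show "nrm (transported j) (j x + j y) \<le> nrm (transported j) (j x) + nrm (transported j) (j y)" for x y
      by (simp add: n norm_triangle_ineq flip: linear_add[OF j(1)])
  qed
  show "complete_on (range j) (nrm (transported j))"
    unfolding complete_on_def
  proof (intro allI impI)
    fix s :: "nat \<Rightarrow> 'a" assume a: "(\<forall>n. s n \<in> range j) \<and>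
      (\<forall>e>0. \<exists>M. \<forall>m\<ge>M. \<forall>n\<ge>M. nrm (transported j) (s m - s n) < e)"
    define r where "r n = inv j (s n)" for n
    have r: "s n = j (r n)" for n using a by (simp add: r_def f_inv_into_f)
    have d: "nrm (transported j) (j x - j y) = norm (x - y)" for x y
      by (simp add: n flip: linear_diff[OF j(1)])
    have "Cauchy r" using a unfolding Cauchy_iff r d by blast
    then obtain l where "r \<longlonglongrightarrow> l" using Cauchy_convergent convergent_def by blast
    then have "(\<lambda>n. norm (r n - l)) \<longlonglongrightarrow> 0" using LIM_zero tendsto_norm_zero by blast
    then show "\<exists>l\<in>range j. (\<lambda>n. nrm (transported j) (s n - l)) \<longlonglongrightarrow> 0"
      unfolding r by (intro bexI[of _ "j l"]) (simp_all add: d)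
  qed
qed

lemma lattice_sum_simps:
  "carr (lattice_sum F X Y) = carr X \<times> carr Y" "nrm (lattice_sum F X Y) (x, y) = F (nrm X x, nrm Y y)"
  by (simp_all add: lattice_sum_def)

lemma banach_completeE:
  fixes s :: "nat \<Rightarrow> 'a::real_vector"
  assumes X: "banach_space X" and s: "\<And>n. s n \<in> carr X"
    and C: "\<And>e. e > 0 \<Longrightarrow> \<exists>M. \<forall>m\<ge>M. \<forall>n\<ge>M. nrm X (s m - s n) < e"
  obtains l where "l \<in> carr X" "(\<lambda>n. nrm X (s n - l)) \<longlonglongrightarrow> 0"
proof -
  have "complete_on (carr X) (nrm X)" using X by (simp add: banach_space_def)
  then have "\<exists>l\<in>carr X. (\<lambda>n. nrm X (s n - l)) \<longlonglongrightarrow> 0"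
    unfolding complete_on_def using s C by simp
  then show thesis using that by blast
qed

text \<open>Each coordinate norm is at most the norm of the sum, so Cauchy sequences are Cauchy in
  each coordinate; conversely \<open>F\<close> is at most the sum of the coordinates, so
  coordinatewise limits are limits. The triangle inequality needs monotonicity of
  \<open>F\<close>.\<close>

lemma banach_space_lattice_sum:
  fixes X :: "'a::real_vector nspace" and Y :: "'b::real_vector nspace"
  assumes F: "two_dim_lattice F" and X: "banach_space X" and Y: "banach_space Y"
  shows "banach_space (lattice_sum F X Y)"
  unfolding banach_space_def
proof (intro conjI)
  let ?S = "lattice_sum F X Y"
  note S = lattice_sum_simps[of F X Y]
  show "subspace (carr ?S)"
    unfolding S using banach_subspace[OF X] banach_subspace[OF Y] by (rule subspace_Times)
  obtain e where e: "e \<in> carr X" "nrm X e = 1" using banach_unit_vector[OF X] .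
  then have "(e, 0) \<in> carr ?S" "e \<noteq> 0"
    using banach_0[OF Y] banach_eq_0[OF X e(1)] by (auto simp: S)
  then show "carr ?S \<noteq> {0}" by (auto simp: zero_prod_def)
  show "norm_on (carr ?S) (nrm ?S)"
    unfolding norm_on_def S
  proof (intro conjI ballI allI; elim SigmaE; hypsubst)
    show "0 \<le> nrm ?S (x, y)" for x y unfolding S by (rule lattice_nonneg[OF F])
    show "nrm ?S (x, y) = 0 \<longleftrightarrow> (x, y) = 0" if "x \<in> carr X" "y \<in> carr Y" for x y
      using that banach_eq_0[OF X] banach_eq_0[OF Y] by (simp add: S lattice_eq_0_iff[OF F] zero_prod_def)
    show "nrm ?S (c *\<^sub>R (x, y)) = \<bar>c\<bar> * nrm ?S (x, y)" if "x \<in> carr X" "y \<in> carr Y" for c x y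
      using that banach_scale[OF X] banach_scale[OF Y] lattice_scale[OF F, of "\<bar>c\<bar>"] by (simp add: S)
    show "nrm ?S ((x, y) + (x', y')) \<le> nrm ?S (x, y) + nrm ?S (x', y')"
      if "x \<in> carr X" "y \<in> carr Y" "x' \<in> carr X" "y' \<in> carr Y" for x y x' y'
    proof -
      have "nrm ?S ((x, y) + (x', y')) = F (nrm X (x + x'), nrm Y (y + y'))" by (simp add: S)
      also have "\<dots> \<le> F (nrm X x + nrm X x', nrm Y y + nrm Y y')"
        using that banach_nonneg[OF X] banach_nonneg[OF Y] banach_triangle[OF X] banach_triangle[OF Y]
          banach_subspace[OF X] banach_subspace[OF Y]
        by (intro lattice_mono[OF F]) (simp_all add: subspace_add)
      also have "\<dots> \<le> nrm ?S (x, y) + nrm ?S (x', y')" unfolding S by (rule lattice_triangle[OF F])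
      finally show ?thesis .
    qed
  qed
  show "complete_on (carr ?S) (nrm ?S)"
    unfolding complete_on_def
  proof (intro allI impI)
    fix s :: "nat \<Rightarrow> 'a \<times> 'b" assume a: "(\<forall>n. s n \<in> carr ?S) \<and>
      (\<forall>e>0. \<exists>M. \<forall>m\<ge>M. \<forall>n\<ge>M. nrm ?S (s m - s n) < e)"
    define x where "x n = fst (s n)" for n
    define y where "y n = snd (s n)" for n
    have s: "s n = (x n, y n)" for n by (simp add: x_def y_def)
    have xy: "x n \<in> carr X" "y n \<in> carr Y" for n using a by (simp_all add: s S)
    have d: "nrm ?S (s m - s n) = F (nrm X (x m - x n), nrm Y (y m - y n))" for m n by (simp add: s S)
    have le: "nrm X (x m - x n) \<le> nrm ?S (s m - s n)" "nrm Y (y m - y n) \<le> nrm ?S (s m - s n)" for m n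
      using lattice_ge_abs[OF F] unfolding d by (meson abs_ge_self order_trans)+
    have cX: "\<forall>e>0. \<exists>M. \<forall>m\<ge>M. \<forall>n\<ge>M. nrm X (x m - x n) < e"
      using a le(1) by (meson order_le_less_trans)
    have cY: "\<forall>e>0. \<exists>M. \<forall>m\<ge>M. \<forall>n\<ge>M. nrm Y (y m - y n) < e"
      using a le(2) by (meson order_le_less_trans)
    obtain l where l: "l \<in> carr X" "(\<lambda>n. nrm X (x n - l)) \<longlonglongrightarrow> 0"
      by (rule banach_completeE[OF X xy(1) cX[rule_format]]) (assumption, rule that)
    obtain k where k: "k \<in> carr Y" "(\<lambda>n. nrm Y (y n - k)) \<longlonglongrightarrow> 0"
      by (rule banach_completeE[OF Y xy(2) cY[rule_format]]) (assumption, rule that)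
    have "(\<lambda>n. nrm ?S (s n - (l, k))) \<longlonglongrightarrow> 0"
    proof (rule tendsto_sandwich[OF always_eventually always_eventually tendsto_const])
      show "(\<lambda>n. \<bar>nrm X (x n - l)\<bar> + \<bar>nrm Y (y n - k)\<bar>) \<longlonglongrightarrow> 0"
        using tendsto_add[OF tendsto_rabs[OF l(2)] tendsto_rabs[OF k(2)]] by simp
    qed (auto simp: s S lattice_le_sum[OF F] lattice_nonneg[OF F])
    then show "\<exists>l\<in>carr ?S. (\<lambda>n. nrm ?S (s n - l)) \<longlonglongrightarrow> 0" using l k by (intro bexI[of _ "(l, k)"]) (auto simp: S)
  qed
qed

section \<open>The general form of rank-1 operators and a criterion for Daugavet centers\<close>

lemma bounded_operator_add:
  assumes X: "banach_space X" and Y: "banach_space Y" and f: "bounded_operator X Y f" and g: "bounded_operator X Y g"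
  shows "bounded_operator X Y (\<lambda>x. f x + g x)"
  unfolding bounded_operator_def
proof (intro conjI)
  have in_Y: "f x \<in> carr Y" "g x \<in> carr Y" if "x \<in> carr X" for x
    using f g that by (simp_all add: bounded_operator_def)
  obtain K where K: "\<forall>x\<in>carr X. nrm Y (f x) \<le> K * nrm X x"
    using f unfolding bounded_operator_def by blast
  obtain L where L: "\<forall>x\<in>carr X. nrm Y (g x) \<le> L * nrm X x"
    using g unfolding bounded_operator_def by blast
  show "\<exists>K. \<forall>x\<in>carr X. nrm Y (f x + g x) \<le> K * nrm X x"
  proof (intro exI ballI)
    fix x assume x: "x \<in> carr X"
    have "nrm Y (f x) \<le> K * nrm X x" "nrm Y (g x) \<le> L * nrm X x" using K L x by simp_all
    then show "nrm Y (f x + g x) \<le> (K + L) * nrm X x"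
      using banach_triangle[OF Y in_Y[OF x]] unfolding distrib_right by linarith
  qed
  show "\<forall>x\<in>carr X. f x + g x \<in> carr Y" using in_Y subspace_add[OF banach_subspace[OF Y]] by simp
  show "\<forall>x\<in>carr X. \<forall>y\<in>carr X. f (x + y) + g (x + y) = f x + g x + (f y + g y)"
    using f g by (simp add: bounded_operator_def)
  show "\<forall>c. \<forall>x\<in>carr X. f (c *\<^sub>R x) + g (c *\<^sub>R x) = c *\<^sub>R (f x + g x)"
    using f g by (simp add: bounded_operator_def scaleR_add_right)
qed

text \<open>The functional is the coordinate with respect to a basis vector \<open>b\<close> of the
  image. It is unique because \<open>b \<noteq> 0\<close>, hence linear, and dividing by the norm of
  \<open>b\<close> bounds it.\<close>

lemma rank1_operatorE:
  assumes X: "banach_space X" and Y: "banach_space Y" and T: "rank1_operator X Y T"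
  obtains \<phi> b where "b \<in> carr Y" "\<And>x. x \<in> carr X \<Longrightarrow> T x = \<phi> x *\<^sub>R b" "bounded_operator X real_line \<phi>"
proof -
  have bT: "bounded_operator X Y T" and dim: "dim (T ` carr X) = 1" using T by (simp_all add: rank1_operator_def)
  obtain B where B: "B \<subseteq> T ` carr X" "independent B" "T ` carr X \<subseteq> span B" "card B = 1"
    using basis_exists[of "T ` carr X"] dim by metis
  obtain b where b: "B = {b}" using B(4) card_1_singletonE by blast
  have b0: "b \<noteq> 0" using B(2) dependent_zero b by auto
  have bY: "b \<in> carr Y" using B(1) bT b by (auto simp: bounded_operator_def)
  define \<phi> where "\<phi> x = (SOME k. T x = k *\<^sub>R b)" for x
  have \<phi>: "T x = \<phi> x *\<^sub>R b" if "x \<in> carr X" for x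
  proof -
    have "T x \<in> span {b}" using B(3) b that by blast
    then have "\<exists>k. T x = k *\<^sub>R b" by (auto simp: span_singleton)
    then show ?thesis unfolding \<phi>_def by (rule someI_ex)
  qed
  have inj: "k *\<^sub>R b = k' *\<^sub>R b \<Longrightarrow> k = k'" for k k' using b0 by simp
  have nb: "nrm Y b > 0" using banach_nonneg[OF Y bY] banach_eq_0[OF Y bY] b0 by simp
  note sX = banach_subspace[OF X]
  have "bounded_operator X real_line \<phi>"
    unfolding bounded_operator_def
  proof (intro conjI ballI allI)
    show "\<phi> (x + y) = \<phi> x + \<phi> y" if "x \<in> carr X" "y \<in> carr X" for x y
    proof (rule inj)
      have "T (x + y) = T x + T y" using bT that by (simp add: bounded_operator_def)
      then show "\<phi> (x + y) *\<^sub>R b = (\<phi> x + \<phi> y) *\<^sub>R b"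
        using \<phi> that subspace_add[OF sX that] by (simp add: scaleR_add_left)
    qed
    show "\<phi> (c *\<^sub>R x) = c *\<^sub>R \<phi> x" if "x \<in> carr X" for c x
    proof (rule inj)
      have "T (c *\<^sub>R x) = c *\<^sub>R T x" using bT that by (simp add: bounded_operator_def)
      then show "\<phi> (c *\<^sub>R x) *\<^sub>R b = (c *\<^sub>R \<phi> x) *\<^sub>R b"
        using \<phi>[OF that] \<phi>[OF subspace_scale[OF sX that, of c]] by simp
    qed
    obtain K where K: "\<forall>x\<in>carr X. nrm Y (T x) \<le> K * nrm X x"
      using bT unfolding bounded_operator_def by blast
    show "\<exists>L. \<forall>x\<in>carr X. nrm real_line (\<phi> x) \<le> L * nrm X x"
    proof (intro exI ballI)
      fix x assume x: "x \<in> carr X"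
      have "\<bar>\<phi> x\<bar> * nrm Y b \<le> K * nrm X x" using K x \<phi>[OF x] banach_scale[OF Y bY] by auto
      then show "nrm real_line (\<phi> x) \<le> (K / nrm Y b) * nrm X x" using nb by (simp add: field_simps)
    qed
  qed simp
  then show thesis using that bY \<phi> by blast
qed

text \<open>The upper estimate is the triangle inequality. For the lower one, \<open>x\<close>
  nearly norms \<open>T\<close> up to \<open>\<epsilon> / 2\<close>, and \<open>z\<close> loses
  another \<open>\<epsilon> / 2\<close>.\<close>

lemma daugavet_centerI:
  assumes X: "banach_space X" and Y: "banach_space Y"
    and G: "bounded_operator X Y G" "x0 \<in> carr X" "G x0 \<noteq> 0"
    and step: "\<And>T x \<epsilon>. rank1_operator X Y T \<Longrightarrow> x \<in> carr X \<Longrightarrow> nrm X x \<le> 1 \<Longrightarrow> \<epsilon> > 0 \<Longrightarrow>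
      \<exists>z\<in>carr X. nrm X z \<le> 1 \<and> nrm Y (G z + T z) \<ge> op_norm X Y G + nrm Y (T x) - \<epsilon>"
  shows "daugavet_center X Y G"
proof -
  have "op_norm X Y (\<lambda>x. G x + T x) = op_norm X Y G + op_norm X Y T" if T: "rank1_operator X Y T" for T
  proof (rule antisym)
    have bT: "bounded_operator X Y T" using T by (simp add: rank1_operator_def)
    note bGT = bounded_operator_add[OF X Y G(1) bT]
    show "op_norm X Y (\<lambda>x. G x + T x) \<le> op_norm X Y G + op_norm X Y T"
    proof (rule ccontr)
      assume "\<not> ?thesis"
      then have "op_norm X Y G + op_norm X Y T < op_norm X Y (\<lambda>x. G x + T x)" by simp
      then obtain x where x: "x \<in> carr X" "nrm X x \<le> 1" "op_norm X Y G + op_norm X Y T < nrm Y (G x + T x)"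
        by (rule op_norm_approx[OF X]) (rule that)
      have "G x \<in> carr Y" "T x \<in> carr Y" using G bT x(1) by (simp_all add: bounded_operator_def)
      from banach_triangle[OF Y this] show False
        using x(3) op_norm_upper[OF G(1) x(1,2) X] op_norm_upper[OF bT x(1,2) X] by linarith
    qed
    show "op_norm X Y G + op_norm X Y T \<le> op_norm X Y (\<lambda>x. G x + T x)"
    proof (rule field_le_epsilon)
      fix \<epsilon> :: real assume "\<epsilon> > 0"
      then have e: "\<epsilon> / 2 > 0" by simp
      then have "op_norm X Y T - \<epsilon> / 2 < op_norm X Y T" by linarith
      then obtain x where x: "x \<in> carr X" "nrm X x \<le> 1" "op_norm X Y T - \<epsilon> / 2 < nrm Y (T x)"
        by (rule op_norm_approx[OF X]) (rule that)
      obtain z where z: "z \<in> carr X" "nrm X z \<le> 1" "nrm Y (G z + T z) \<ge> op_norm X Y G + nrm Y (T x) - \<epsilon> / 2"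
        using step[OF T x(1,2) e] by blast
      show "op_norm X Y G + op_norm X Y T \<le> op_norm X Y (\<lambda>x. G x + T x) + \<epsilon>"
        using op_norm_upper[OF bGT z(1,2) X] z(3) x(3) by linarith
    qed
  qed
  then show ?thesis using G unfolding daugavet_center_def by blast
qed

lemma const_bcontfun_1_nonzero: "const_bcontfun 1 \<noteq> (0 :: real \<Rightarrow>\<^sub>C real)"
proof
  assume eq: "const_bcontfun 1 = (0 :: real \<Rightarrow>\<^sub>C real)"
  have "apply_bcontfun (const_bcontfun 1) (0 :: real) = apply_bcontfun (0 :: real \<Rightarrow>\<^sub>C real) 0"
    by (simp only: eq)
  then show False by simp
qed

text \<open>\<open>F (p, q) = 1\<close> makes the map isometric. The peaks give one estimate per
  coordinate, and \<open>cone_point_add\<close> combines them into the Daugavet equation for the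
  norm \<open>F\<close>.\<close>

lemma daugavet_center_diagonal:
  fixes ja :: "(real \<Rightarrow>\<^sub>C real) \<Rightarrow> 'a::real_vector" and jb :: "(real \<Rightarrow>\<^sub>C real) \<Rightarrow> 'b::real_vector"
    and je :: "(real \<Rightarrow>\<^sub>C real) \<Rightarrow> 'e::real_vector"
  assumes F: "two_dim_lattice F" and c: "cone_point F p q"
    and ja: "linear ja" "inj ja" and jb: "linear jb" "inj jb" and je: "linear je" "inj je"
  shows "daugavet_center (transported je) (lattice_sum F (transported ja) (transported jb))
    (\<lambda>e. (ja (p *\<^sub>R inv je e), jb (q *\<^sub>R inv je e)))"
proof -
  let ?E = "transported je" and ?Y = "lattice_sum F (transported ja) (transported jb)"
  let ?G = "\<lambda>e. (ja (p *\<^sub>R inv je e), jb (q *\<^sub>R inv je e))"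
  let ?one = "const_bcontfun 1 :: real \<Rightarrow>\<^sub>C real"
  note pq = c[unfolded cone_point_def]
  note nz = const_bcontfun_1_nonzero
  have one: "norm ?one \<le> 1" by (rule norm_bound) simp
  have one': "norm ?one \<ge> 1" using norm_bounded[of ?one 0] by simp
  note E = banach_space_transported[OF je nz]
  note Y = banach_space_lattice_sum[OF F banach_space_transported[OF ja nz] banach_space_transported[OF jb nz]]
  note nE = nrm_transported[OF je(2)]
  have nY: "nrm ?Y (ja u, jb v) = F (norm u, norm v)" for u v
    by (simp add: lattice_sum_simps nrm_transported[OF ja(2)] nrm_transported[OF jb(2)])
  have inv: "inv je (je f) = f" for f by (simp add: je(2))
  have nG: "nrm ?Y (?G (je f)) = norm f" for f
  proof -
    have "nrm ?Y (?G (je f)) = F (norm f * p, norm f * q)" using pq by (simp add: nY inv mult.commute)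
    also have "\<dots> = norm f" unfolding lattice_scale[OF F] using pq by simp
    finally show ?thesis .
  qed
  have bG: "bounded_operator ?E ?Y ?G"
    unfolding bounded_operator_def carr_transported
  proof (intro conjI ballI allI; (elim rangeE)?; (hypsubst)?)
    show "?G (je f) \<in> carr ?Y" for f by (simp add: lattice_sum_simps carr_transported)
    show "?G (je f + je g) = ?G (je f) + ?G (je g)" for f g
      unfolding linear_add[OF je(1), symmetric] inv
      by (simp add: scaleR_add_right linear_add[OF ja(1)] linear_add[OF jb(1)])
    show "?G (k *\<^sub>R je f) = k *\<^sub>R ?G (je f)" for k f
      unfolding linear_scale[OF je(1), symmetric] inv
      by (simp add: linear_scale[OF ja(1)] linear_scale[OF jb(1)] mult.commute)
    show "\<exists>K. \<forall>x\<in>range je. nrm ?Y (?G x) \<le> K * nrm ?E x"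
      using nG nE by (intro exI[of _ 1]) auto
  qed
  have "op_norm ?E ?Y ?G = 1"
  proof (rule antisym)
    show "op_norm ?E ?Y ?G \<le> 1"
    proof (rule ccontr)
      assume "\<not> ?thesis"
      then have "1 < op_norm ?E ?Y ?G" by simp
      then obtain x where x: "x \<in> carr ?E" "nrm ?E x \<le> 1" "1 < nrm ?Y (?G x)"
        by (rule op_norm_approx[OF E]) (rule that)
      then obtain f where "x = je f" by (auto simp: carr_transported)
      then show False using x nG nE by simp
    qed
    show "1 \<le> op_norm ?E ?Y ?G"
      using op_norm_upper[OF bG _ _ E, of "je ?one"] one one' nG nE by (simp add: carr_transported)
  qed
  note opG = this
  show ?thesis
  proof (rule daugavet_centerI[OF E Y bG])
    show "je ?one \<in> carr ?E" by (simp add: carr_transported)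
    have "nrm ?Y (?G (je ?one)) \<noteq> 0" unfolding nG using one' by linarith
    then show "?G (je ?one) \<noteq> 0" using banach_eq_0[OF Y banach_0[OF Y]] by metis
  next
    fix T x and \<epsilon> :: real
    assume T: "rank1_operator ?E ?Y T" and x: "x \<in> carr ?E" "nrm ?E x \<le> 1" and \<epsilon>: "\<epsilon> > 0"
    obtain \<phi> b where b: "b \<in> carr ?Y" and Tb: "\<And>x. x \<in> carr ?E \<Longrightarrow> T x = \<phi> x *\<^sub>R b"
      and \<phi>: "bounded_operator ?E real_line \<phi>"
      by (rule rank1_operatorE[OF E Y T]) (rule that)
    obtain y1 y2 where y: "b = (ja y1, jb y2)" using b by (auto simp: lattice_sum_simps carr_transported)
    obtain f where f: "x = je f" using x(1) by (auto simp: carr_transported)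
    \<comment> \<open>The functional is pulled back to the function space, where peaks can be
      prescribed.\<close>
    define \<psi> where "\<psi> h = \<phi> (je h)" for h
    have \<psi>: "linear \<psi>"
      by (rule linearI)
        (use \<phi> in \<open>simp_all add: \<psi>_def bounded_operator_def carr_transported linear_add[OF je(1)] linear_scale[OF je(1)]\<close>)
    obtain K where "\<forall>x\<in>carr ?E. nrm real_line (\<phi> x) \<le> K * nrm ?E x"
      using \<phi> unfolding bounded_operator_def by blast
    then have K: "\<bar>\<psi> h\<bar> \<le> K * norm h" for h by (simp add: \<psi>_def carr_transported nE)
    have T: "T (je h) = (ja (\<psi> h *\<^sub>R y1), jb (\<psi> h *\<^sub>R y2))" for h
      using Tb[of "je h"] by (simp add: carr_transported \<psi>_def y linear_scale[OF ja(1)] linear_scale[OF jb(1)])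
    have nf: "norm f \<le> 1" using x(2) f nE by simp
    have e: "\<epsilon> / 2 > 0" using \<epsilon> by simp
    obtain h where h: "norm h \<le> 1"
      "norm (p *\<^sub>R h + \<psi> h *\<^sub>R y1) \<ge> p + \<bar>\<psi> f\<bar> * norm y1 - \<epsilon> / 2"
      "norm (q *\<^sub>R h + \<psi> h *\<^sub>R y2) \<ge> q + \<bar>\<psi> f\<bar> * norm y2 - \<epsilon> / 2"
      by (rule simultaneous_peaks[OF \<psi> K nf e]) (rule that)
    let ?A = "norm (p *\<^sub>R h + \<psi> h *\<^sub>R y1)" and ?B = "norm (q *\<^sub>R h + \<psi> h *\<^sub>R y2)"
    have GT: "nrm ?Y (?G (je h) + T (je h)) = F (?A, ?B)"
      unfolding T inv add_Pair linear_add[OF ja(1), symmetric] linear_add[OF jb(1), symmetric] nY ..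
    have nn: "0 \<le> \<bar>\<psi> f\<bar> * norm y1" "0 \<le> \<bar>\<psi> f\<bar> * norm y2" by simp_all
    have "1 + nrm ?Y (T (je f)) = 1 + F (\<bar>\<psi> f\<bar> * norm y1, \<bar>\<psi> f\<bar> * norm y2)" unfolding T nY by simp
    also have "\<dots> = F (p + \<bar>\<psi> f\<bar> * norm y1, q + \<bar>\<psi> f\<bar> * norm y2)"
      using cone_point_add[OF F c nn] by simp
    \<comment> \<open>Monotonicity takes over both coordinate estimates at once; the two errors of
      \<open>\<epsilon> / 2\<close> together cost at most \<open>\<epsilon>\<close>.\<close>
    also have "\<dots> \<le> F (?A + \<epsilon> / 2, ?B + \<epsilon> / 2)"
      using h(2,3) pq nn by (intro lattice_mono[OF F]) auto
    also have "\<dots> \<le> F (?A, ?B) + F (\<epsilon> / 2, \<epsilon> / 2)" by (rule lattice_triangle[OF F])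
    also have "F (\<epsilon> / 2, \<epsilon> / 2) \<le> \<epsilon>" using lattice_le_sum[OF F, of "\<epsilon> / 2" "\<epsilon> / 2"] \<epsilon> by simp
    finally have "1 + nrm ?Y (T (je f)) - \<epsilon> \<le> F (?A, ?B)" by simp
    then have "nrm ?Y (?G (je h) + T (je h)) \<ge> op_norm ?E ?Y ?G + nrm ?Y (T x) - \<epsilon>"
      unfolding GT opG f .
    then show "\<exists>z\<in>carr ?E. nrm ?E z \<le> 1 \<and> nrm ?Y (?G z + T z) \<ge> op_norm ?E ?Y ?G + nrm ?Y (T x) - \<epsilon>"
      using h(1) nE by (intro bexI[of _ "je h"]) (simp_all add: carr_transported)
  qed
qed

theorem corollary6p7:
  fixes F :: "real \<times> real \<Rightarrow> real"
  assumes "two_dim_lattice F"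
    and "\<exists>B :: 'a::real_vector set. independent B \<and> (UNIV :: real set) \<lesssim> B"
    and "\<exists>B :: 'b::real_vector set. independent B \<and> (UNIV :: real set) \<lesssim> B"
    and "\<exists>B :: 'e::real_vector set. independent B \<and> (UNIV :: real set) \<lesssim> B"
  shows "(\<exists>(X1 :: 'a nspace) (X2 :: 'b nspace).
            banach_space X1 \<and> banach_space X2 \<and>
            daugavet_range TYPE('e) (lattice_sum F X1 X2))
         \<longleftrightarrow> F \<in> N2"
proof
  assume "\<exists>(X1 :: 'a nspace) (X2 :: 'b nspace).
    banach_space X1 \<and> banach_space X2 \<and> daugavet_range TYPE('e) (lattice_sum F X1 X2)"
  then show "F \<in> N2"
    using daugavet_range_imp_cone_point[OF assms(1)] cone_point_imp_N2[OF assms(1)] by metis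
next
  assume "F \<in> N2"
  then obtain p q where c: "cone_point F p q" using N2_imp_cone_point by blast
  obtain ja :: "(real \<Rightarrow>\<^sub>C real) \<Rightarrow> 'a" where ja: "linear ja" "inj ja"
    using linear_embedding_exists[OF assms(2)] .
  obtain jb :: "(real \<Rightarrow>\<^sub>C real) \<Rightarrow> 'b" where jb: "linear jb" "inj jb"
    using linear_embedding_exists[OF assms(3)] .
  obtain je :: "(real \<Rightarrow>\<^sub>C real) \<Rightarrow> 'e" where je: "linear je" "inj je"
    using linear_embedding_exists[OF assms(4)] .
  note nz = const_bcontfun_1_nonzero
  note B = banach_space_transported[OF ja nz] banach_space_transported[OF jb nz]
    banach_space_transported[OF je nz]
  have "daugavet_range TYPE('e) (lattice_sum F (transported ja) (transported jb))"
    unfolding daugavet_range_def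
    using banach_space_lattice_sum[OF assms(1) B(1,2)] B(3)
      daugavet_center_diagonal[OF assms(1) c ja jb je] by blast
  then show "\<exists>(X1 :: 'a nspace) (X2 :: 'b nspace).
    banach_space X1 \<and> banach_space X2 \<and> daugavet_range TYPE('e) (lattice_sum F X1 X2)"
    using B(1,2) by blast
qed

end
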